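(* Let $\alpha$ be a probability distribution on $[d]$ with $\alpha_1\ge\cdots\ge\alpha_d$, $n\in\mathbb N$, $\lambda\sim\mathrm{SW}^n(\alpha)$. Then for every $k\in[d]$, \[ \mathbb E\Big[\sum_{i=k}^d\lambda_i^2\Big]\le\sum_{i=k}^d(\alpha_i n)^2+d\,(\alpha_k+\alpha_{k+1}+\cdots+\alpha_d)\,n. \]
   Context: $\mathrm{SW}^n(\alpha)$ is the law of the RSK shape $\mathrm{shRSK}(\boldsymbol w)$ (Young diagram $\lambda_1\ge\cdots\ge\lambda_d\ge0$ whose first $k$ rows sum to the maximum total length of $k$ disjoint weakly increasing subsequences of $\boldsymbol w$), where $\boldsymbol w\in[d]^n$ has i.i.d. letters with law $\alpha$. *)

theory Defs
  imports "HOL-Probability.Probability"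
begin

definition weakly_incr_subseq :: "nat list \<Rightarrow> nat set \<Rightarrow> bool" where
  "weakly_incr_subseq w S \<longleftrightarrow> S \<subseteq> {..<length w} \<and>
     (\<forall>i\<in>S. \<forall>j\<in>S. i < j \<longrightarrow> w ! i \<le> w ! j)"

definition greene :: "nat list \<Rightarrow> nat \<Rightarrow> nat" where
  "greene w k = Max {(\<Sum>i<k. card (S i)) | S :: nat \<Rightarrow> nat set.
      (\<forall>i<k. weakly_incr_subseq w (S i)) \<and>
      (\<forall>i<k. \<forall>j<k. i \<noteq> j \<longrightarrow> S i \<inter> S j = {})}"

text \<open>RSK shape: row i (for i \<ge> 1) is lambda_i, characterized by
  lambda_1 + ... + lambda_k = greene w k. Rows are indexed from 1.\<close>
definition shRSK :: "nat list \<Rightarrow> nat \<Rightarrow> nat" where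
  "shRSK w i = greene w i - greene w (i - 1)"

definition SW :: "nat \<Rightarrow> nat pmf \<Rightarrow> (nat \<Rightarrow> nat) pmf" where
  "SW n \<alpha> = map_pmf shRSK (replicate_pmf n \<alpha>)"

end

theory Submission
  imports Defs "Jordan_Normal_Form.Determinant"
begin

text \<open>Crystal operators change one letter \<open>a\<close> into \<open>a + 1\<close> or back without changing the Greene numbers:
  an optimal family of chains can be repaired by exchanging tails. Raising any word to a
  Yamanouchi word, whose shape is its content, shows that the rows \<open>k, ..., d\<close> of the shape are weakly
  majorised by the shape \<open>\<mu>\<close> of the subword of letters \<open>\<ge> k\<close>, since raising \<open>k\<close> to \<open>k - 1\<close>
  only deletes a letter of that subword. It remains to bound the expectation of \<open>\<Sum> \<mu>\<^sub>j\<^sup>2\<close>.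

  With \<open>\<delta>\<close> the staircase, multiply the generating polynomial of \<open>\<bar>\<mu> + \<delta>\<bar>\<^sup>2\<close> over all words by the
  Vandermonde alternant. Reflecting the prefix before the shortest suffix that is not Yamanouchi is a
  shape-preserving involution that reverses the sign of the alternant with exponent content \<open>+ \<delta>\<close>,
  so only Yamanouchi words survive, and for them \<open>\<mu>\<close> may be replaced by the content.
  The same cancellation, read backwards, gives a sum over all words of
  \<open>\<bar>content + \<delta>\<bar>\<^sup>2\<close>, which consists of multinomial moments. Thus the expectation of
  \<open>\<Sum> \<mu>\<^sub>j\<^sup>2 - (2j - 1) \<mu>\<^sub>j\<close> is \<open>n (n - 1) \<Sum> \<alpha>\<^sub>i\<^sup>2\<close>, and Chebyshev's sum inequality bounds the linear term.\<close>

section \<open>Families of disjoint chains\<close>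

text \<open>The involution evaluates all rows of a shape together, not a tail of them. Hence rows k,
  ..., d are first traded, by an inequality, for all rows of a shape on D = d - k + 1 letters.
  Letters below k stay in the word as a blank, so the length remains n and the active weights can
  vary freely. The product with the alternant can be handled because every function of the shape has
  a generating polynomial symmetric in the active weights, so it factors out of an alternating sum
  over permutations. The staircase is forced by the involution: the shortest bad suffix has exactly
  one letter a + 1 in excess, so reflecting the prefix before it exchanges two multiplicities only
  up to one. Adding the staircase turns this into an exact transposition. The alternant vanishes
  when two active weights coincide, so it is cancelled at distinct weights and a limit follows.
  Origin of the factor d: the coefficients 2j - 1 for j = 1, ..., D have mean D, and decreasing rows
  allow replacing them by their mean; then D \<le> d, and n(n - 1) \<le> n^2.\<close>

definition chain_family :: "('a::linorder \<Rightarrow> 'b::linorder) \<Rightarrow> 'a set \<Rightarrow> nat \<Rightarrow> (nat \<Rightarrow> 'a set) \<Rightarrow> bool" where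
  "chain_family f P k S \<longleftrightarrow>
     (\<forall>i<k. S i \<subseteq> P \<and> (\<forall>x\<in>S i. \<forall>y\<in>S i. x < y \<longrightarrow> f x \<le> f y)) \<and>
     (\<forall>i<k. \<forall>j<k. i \<noteq> j \<longrightarrow> S i \<inter> S j = {})"

definition family_size :: "nat \<Rightarrow> (nat \<Rightarrow> 'a set) \<Rightarrow> nat" where
  "family_size k S = (\<Sum>i<k. card (S i))"

lemma chain_familyD:
  assumes "chain_family f P k S"
  shows "i < k \<Longrightarrow> S i \<subseteq> P"
    and "i < k \<Longrightarrow> x \<in> S i \<Longrightarrow> y \<in> S i \<Longrightarrow> x < y \<Longrightarrow> f x \<le> f y"
    and "i < k \<Longrightarrow> j < k \<Longrightarrow> i \<noteq> j \<Longrightarrow> x \<in> S i \<Longrightarrow> x \<notin> S j"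
  using assms unfolding chain_family_def by (auto, blast+)

lemma family_size_UN:
  assumes "finite P" "chain_family f P k S"
  shows "family_size k S = card (\<Union>i<k. S i)"
  unfolding family_size_def
  by (rule card_UN_disjoint[symmetric])
     (use assms in \<open>auto simp: chain_family_def intro: finite_subset\<close>)

lemma family_size_le:
  assumes "finite P" "chain_family f P k S"
  shows "family_size k S \<le> card P"
  unfolding family_size_UN[OF assms]
  by (rule card_mono) (use assms in \<open>auto simp: chain_family_def\<close>)

text \<open>The two disjuncts in the last hypothesis cover maps that preserve and maps that reverse
  the order of positions; reversal is what turns the raising argument into the lowering one.\<close>

lemma chain_family_transfer:
  assumes "chain_family f P k S" and "inj_on \<phi> P" and "\<phi> ` P \<subseteq> P'"
    and "\<And>x y. x \<in> P \<Longrightarrow> y \<in> P \<Longrightarrow> \<phi> x < \<phi> y \<Longrightarrow>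
           (x < y \<and> (f x \<le> f y \<longrightarrow> f' (\<phi> x) \<le> f' (\<phi> y))) \<or>
           (y < x \<and> (f y \<le> f x \<longrightarrow> f' (\<phi> x) \<le> f' (\<phi> y)))"
  shows "chain_family f' P' k (\<lambda>i. \<phi> ` S i)" "family_size k (\<lambda>i. \<phi> ` S i) = family_size k S"
proof -
  note C = chain_familyD[OF assms(1)]
  show "chain_family f' P' k (\<lambda>i. \<phi> ` S i)"
    unfolding chain_family_def
  proof (intro conjI allI impI ballI)
    fix i assume "i < k"
    then show "\<phi> ` S i \<subseteq> P'" using C(1) assms(3) by blast
  next
    fix i u v assume i: "i < k" and "u \<in> \<phi> ` S i" "v \<in> \<phi> ` S i" "u < v"
    then obtain x y where xy: "x \<in> S i" "y \<in> S i" "u = \<phi> x" "v = \<phi> y" by blast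
    then have "x \<in> P" "y \<in> P" using C(1) i by blast+
    from assms(4)[OF this] \<open>u < v\<close> xy C(2)[OF i xy(1,2)] C(2)[OF i xy(2,1)]
    show "f' u \<le> f' v" by auto
  next
    fix i j assume ij: "i < k" "j < k" "i \<noteq> j"
    then have "S i \<inter> S j = {}" "S i \<subseteq> P" "S j \<subseteq> P" using C by blast+
    then show "\<phi> ` S i \<inter> \<phi> ` S j = {}"
      using inj_on_image_Int[OF assms(2)] by (metis image_empty)
  qed
  show "family_size k (\<lambda>i. \<phi> ` S i) = family_size k S"
    unfolding family_size_def
    by (rule sum.cong) (use C(1) assms(2) in \<open>auto intro!: card_image intro: inj_on_subset\<close>)
qed

lemma chain_family_raise:
  fixes f :: "'a::linorder \<Rightarrow> 'b::linorder"
  assumes fin: "finite P" and pP: "p \<in> P" and fp: "f p = a" and ab: "a < b"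
    and gap: "\<And>q. q \<in> P \<Longrightarrow> f q \<le> a \<or> b \<le> f q"
    and dom: "\<And>r. card {q\<in>P. p < q \<and> q < r \<and> f q = a} \<le> card {q\<in>P. p < q \<and> q < r \<and> f q = b}"
    and dom': "card {q\<in>P. p < q \<and> f q = a} \<le> card {q\<in>P. p < q \<and> f q = b}"
    and S: "chain_family f P k S"
  shows "\<exists>S'. chain_family (f(p := b)) P k S' \<and> family_size k S \<le> family_size k S'"
proof -
  note C = chain_familyD[OF S]
  have finS: "finite (S i)" if "i < k" for i using C(1)[OF that] fin by (rule finite_subset)
  show ?thesis
  proof (cases "\<exists>c<k. p \<in> S c")
    case False
    then have "chain_family (f(p := b)) P k S"
      using S unfolding chain_family_def by (auto; metis)
    then show ?thesis by blast
  next
    case True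
    then obtain c where c: "c < k" "p \<in> S c" by blast
    have before_c: "f x \<le> a" if "x \<in> S c" "x < p" for x using C(2)[OF c(1) that(1) c(2) that(2)] fp by simp
    have after_c: "a \<le> f x" if "x \<in> S c" "p < x" for x using C(2)[OF c(1) c(2) that(1) that(2)] fp by simp
    show ?thesis
    proof (cases "\<exists>e<k. e \<noteq> c \<and> (\<forall>x\<in>S e. (x < p \<longrightarrow> f x \<le> b) \<and> (p < x \<longrightarrow> b \<le> f x))")
      case True
      then obtain e where e: "e < k" "e \<noteq> c" "\<forall>x\<in>S e. (x < p \<longrightarrow> f x \<le> b) \<and> (p < x \<longrightarrow> b \<le> f x)" by blast
      define S' where "S' = S(e := insert p (S e), c := S c - {p})"
      have "p \<notin> S j" if "j < k" "j \<noteq> c" for j using C(3)[OF c(1) that(1)] that(2) c(2) by auto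
      have pe: "p \<notin> S e" using C(3)[OF c(1) e(1)] e(2) c(2) by auto
      have 1: "chain_family (f(p := b)) P k S'"
        unfolding chain_family_def
      proof (intro conjI allI impI ballI)
        fix i assume "i < k" then show "S' i \<subseteq> P" using C(1) pP by (auto simp: S'_def)
      next
        fix i x y assume *: "i < k" "x \<in> S' i" "y \<in> S' i" "x < y"
        show "(f(p := b)) x \<le> (f(p := b)) y"
        proof (cases "i = e")
          case True
          then show ?thesis using * e(2,3) C(2)[OF e(1), of x y] by (auto simp: S'_def)
        next
          case False
          then have "x \<in> S i" "y \<in> S i" "x \<noteq> p" "y \<noteq> p"
            using * c C(3)[OF c(1) *(1), of p] by (auto simp: S'_def split: if_splits)
          then show ?thesis using C(2)[OF *(1)] * by auto
        qed
      next
        fix i j assume ij: "i < k" "j < k" "i \<noteq> j"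
        then have "S i \<inter> S j = {}" using C(3) by blast
        then show "S' i \<inter> S' j = {}" using C(3)[OF c(1) ij(1), of p] C(3)[OF c(1) ij(2), of p] ij c
          by (auto simp: S'_def)
      qed
      have "(\<Union>i<k. S' i) = (\<Union>i<k. S i)"
      proof (rule Set.set_eqI)
        fix x
        show "x \<in> (\<Union>i<k. S' i) \<longleftrightarrow> x \<in> (\<Union>i<k. S i)"
        proof
          assume "x \<in> (\<Union>i<k. S' i)"
          then show "x \<in> (\<Union>i<k. S i)" using c e by (auto simp: S'_def split: if_splits)
        next
          assume "x \<in> (\<Union>i<k. S i)"
          then obtain i where i: "i < k" "x \<in> S i" by blast
          show "x \<in> (\<Union>i<k. S' i)"
          proof (cases "x = p")
            case True
            then have "x \<in> S' e" using e by (auto simp: S'_def)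
            then show ?thesis using e by blast
          next
            case False
            then have "x \<in> S' i" using i by (auto simp: S'_def)
            then show ?thesis using i by blast
          qed
        qed
      qed
      then show ?thesis using 1 family_size_UN[OF fin S] family_size_UN[OF fin 1] by auto
    next
      case noabs: False
      \<comment> \<open>Before \<open>p\<close> a live chain only uses letters at most \<open>a\<close>, so it can take over the tail of
        another live chain.\<close>
      define live where "live = (\<lambda>e. e = c \<or> \<not>(\<exists>x\<in>S e. x < p \<and> b < f x))"
      have live_before: "f x \<le> a" if "e < k" "live e" "x \<in> S e" "x < p" for e x
      proof (cases "e = c")
        case True then show ?thesis using before_c that by auto
      next
        case False
        then have "\<forall>x\<in>S e. x < p \<longrightarrow> f x \<le> b" using that unfolding live_def by auto
        \<comment> \<open>Since the letters before \<open>p\<close> are no obstacle, absorption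
          fails because of a letter below \<open>b\<close> after \<open>p\<close>; by
          \<open>gap\<close> it is at most \<open>a\<close>, and it bounds everything earlier in the
          chain.\<close>
        with noabs False that(1) obtain y where y: "y \<in> S e" "p < y" "f y < b"
          by (metis not_le_imp_less)
        then have "f y \<le> a" using gap C(1) that(1) by (metis leD subsetD)
        moreover have "f x \<le> f y" using C(2)[OF that(1) that(3) y(1)] that(4) y(2) by auto
        ultimately show ?thesis by auto
      qed
      have dead_after: "b < f x" if "e < k" "\<not> live e" "x \<in> S e" "p < x" for e x
        using that C(2)[OF that(1)] unfolding live_def
        by (metis dual_order.strict_trans order_less_le_trans)
      define U where "U = {q\<in>P. p < q \<and> (\<exists>e<k. live e \<and> q \<in> S e) \<and> b \<le> f q}"
      have finU: "finite U" using fin by (auto simp: U_def)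
      \<comment> \<open>\<open>between\<close> is the set of positions after \<open>p\<close> before the first live use of a letter at least \<open>b\<close>;
        \<open>D\<close> is the chain making that use.\<close>
      obtain D between where D: "D < k" "live D"
        and bet: "\<And>x. x \<in> between \<Longrightarrow> p < x" "\<And>x y. x \<in> between \<Longrightarrow> p < y \<Longrightarrow> y \<le> x \<Longrightarrow> y \<in> between"
        and betlive: "\<And>e x. e < k \<Longrightarrow> live e \<Longrightarrow> x \<in> S e \<Longrightarrow> x \<in> between \<Longrightarrow> f x \<le> a"
        and betcard: "card {q\<in>P. q \<in> between \<and> f q = a} \<le> card {q\<in>P. q \<in> between \<and> f q = b}"
        and tailD: "\<And>x. x \<in> S D \<Longrightarrow> p < x \<Longrightarrow> x \<notin> between \<Longrightarrow> b \<le> f x"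
      proof (cases "U = {}")
        case True
        show thesis
        proof (rule that[of c "{x. p < x}"])
          show "f x \<le> a" if "e < k" "live e" "x \<in> S e" "x \<in> {x. p < x}" for e x
            using True that gap[of x] C(1)[OF that(1)] unfolding U_def by blast
        qed (use c dom' in \<open>auto simp: live_def\<close>)
      next
        case False
        define r where "r = Min U"
        have rU: "r \<in> U" using False finU by (simp add: r_def)
        have rmin: "r \<le> x" if "x \<in> U" for x using that finU by (simp add: r_def)
        from rU obtain D where D: "D < k" "live D" "r \<in> S D" "p < r" "b \<le> f r" by (auto simp: U_def)
        show thesis
        proof (rule that[of D "{x. p < x \<and> x < r}"])
          show "f x \<le> a" if "e < k" "live e" "x \<in> S e" "x \<in> {x. p < x \<and> x < r}" for e x
          proof (rule ccontr)
            assume "\<not> f x \<le> a"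
            then have "x \<in> U" using that gap[of x] C(1)[OF that(1)] unfolding U_def by blast
            then show False using rmin that(4) by force
          qed
          show "card {q \<in> P. q \<in> {x. p < x \<and> x < r} \<and> f q = a} \<le> card {q \<in> P. q \<in> {x. p < x \<and> x < r} \<and> f q = b}"
            using dom[of r] by (simp add: conj_assoc)
          show "b \<le> f x" if "x \<in> S D" "p < x" "x \<notin> {x. p < x \<and> x < r}" for x
          proof -
            have "r \<le> x" using that by auto
            then show ?thesis using C(2)[OF D(1) D(3) that(1)] D(5) by (cases "r = x") (auto intro: order_trans)
          qed
        qed (use D in auto)
      qed
      define late where "late = {x. p < x \<and> x \<notin> between}"
      have late: "x < y" if "x \<in> between" "y \<in> late" for x y
        using that bet(2)[of x y] unfolding late_def by force
      define M where "M = {q\<in>P. q \<in> between \<and> f q = b}"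
      \<comment> \<open>\<open>c\<close> runs through \<open>p\<close> as a \<open>b\<close>,
        collects the free \<open>b\<close>s in \<open>between\<close> and continues with the tail of
        \<open>D\<close>; \<open>D\<close> keeps its letters up to \<open>a\<close> and takes the
        tail of \<open>c\<close>, which is at least \<open>a\<close>. Only the \<open>a\<close>s of
        \<open>c\<close> in \<open>between\<close> are lost, and \<open>betcard\<close> pays for
        them with \<open>M\<close>. If \<open>D = c\<close>, the later update by \<open>newc\<close>
        wins and no tails are exchanged.\<close>
      define newc where "newc = {x\<in>S c. x < p} \<union> {p} \<union> M \<union> {x\<in>S D. x \<in> late}"
      define newD where "newD = {x\<in>S D. x < p} \<union> {x\<in>S D. x \<in> between} \<union> {x\<in>S c. x \<in> late}"
      define S' where "S' = S(D := newD, c := newc)"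
      have Mout: "x \<notin> S e" if "x \<in> M" "e < k" for x e
      proof
        assume x: "x \<in> S e"
        show False
        proof (cases "live e")
          case True
          then show False using betlive[OF that(2) True x] that(1) ab by (auto simp: M_def)
        next
          case False
          then show False using dead_after[OF that(2) False x] that(1) bet(1) by (auto simp: M_def)
        qed
      qed
      have pnot: "p \<notin> S e" if "e < k" "e \<noteq> c" for e using C(3)[OF c(1) that(1)] that(2) c(2) by auto
      have plate: "p \<notin> late" "p \<notin> between" using bet(1) by (auto simp: late_def)
      have 1: "chain_family (f(p := b)) P k S'"
        unfolding chain_family_def
      proof (intro conjI allI impI ballI)
        fix i assume "i < k" then show "S' i \<subseteq> P" using C(1)[OF \<open>i < k\<close>] C(1)[OF D(1)] C(1)[OF c(1)] pP
          by (auto simp: S'_def newc_def newD_def M_def)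
      next
        fix i x y assume *: "i < k" "x \<in> S' i" "y \<in> S' i" "x < y"
        consider "i = c" | "i = D" "i \<noteq> c" | "i \<noteq> c" "i \<noteq> D" by blast
        then show "(f(p := b)) x \<le> (f(p := b)) y"
        proof cases
          case 1
          then have xy: "x \<in> newc" "y \<in> newc" using * by (auto simp: S'_def)
          have val: "(z < p \<and> f z \<le> a \<and> z \<in> S c) \<or> z = p \<or> (z \<in> between \<and> p < z \<and> f z = b) \<or> (z \<in> late \<and> p < z \<and> b \<le> f z \<and> z \<in> S D)"
            if "z \<in> newc" for z
            using that before_c tailD bet(1) by (auto simp: newc_def late_def M_def)
          from val[OF xy(1)] val[OF xy(2)] * late[of y x] C(2)[OF c(1), of x y] C(2)[OF D(1), of x y] ab
          show ?thesis by (elim disjE) auto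
        next
          case 2
          then have xy: "x \<in> newD" "y \<in> newD" using * by (auto simp: S'_def)
          have val: "(z < p \<and> f z \<le> a \<and> z \<in> S D) \<or> (z \<in> between \<and> p < z \<and> f z \<le> a \<and> z \<in> S D) \<or> (z \<in> late \<and> p < z \<and> a \<le> f z \<and> z \<in> S c)"
            if "z \<in> newD" for z
            using that live_before[OF D, of z] betlive[OF D, of z] after_c bet(1) by (auto simp: newD_def late_def)
          from val[OF xy(1)] val[OF xy(2)] * late[of y x] C(2)[OF c(1), of x y] C(2)[OF D(1), of x y]
          show ?thesis by (elim disjE) auto
        next
          case 3
          then have xy: "x \<in> S i" "y \<in> S i" using * by (auto simp: S'_def)
          then have "x \<noteq> p" "y \<noteq> p" using pnot[OF *(1)] 3 by auto
          then show ?thesis using C(2)[OF *(1) xy *(4)] by auto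
        qed
      next
        fix i j assume ij: "i < k" "j < k" "i \<noteq> j"
        have dj: "S e \<inter> S e' = {}" if "e < k" "e' < k" "e \<noteq> e'" for e e' using that C(3) by blast
        have nn: "newc \<inter> newD = {}" if "D \<noteq> c"
          using dj[OF D(1) c(1) that] Mout[of _ D] Mout[of _ c] D(1) c(1) pnot[OF D(1) that] plate bet(1)
          by (auto simp: newc_def newD_def late_def)
        have nc: "newc \<inter> S e = {}" if "e < k" "e \<noteq> c" "e \<noteq> D" for e
          using dj[OF that(1) c(1) that(2)] dj[OF that(1) D(1) that(3)] Mout[OF _ that(1)] pnot[OF that(1,2)]
          by (auto simp: newc_def)
        have nD: "newD \<inter> S e = {}" if "e < k" "e \<noteq> c" "e \<noteq> D" for e
          using dj[OF that(1) c(1) that(2)] dj[OF that(1) D(1) that(3)]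
          by (auto simp: newD_def)
        show "S' i \<inter> S' j = {}"
          using nn nc[OF ij(1)] nc[OF ij(2)] nD[OF ij(1)] nD[OF ij(2)] dj[OF ij] ij
          unfolding S'_def by (auto simp: Int_commute)
      qed
      have "family_size k S \<le> family_size k S'"
      proof -
        define B where "B = {x\<in>S c. x \<in> between}"
        have finM: "finite M" using fin by (auto simp: M_def)
        have BM: "card B \<le> card M"
        proof -
          have "f x = a" if "x \<in> B" for x
            using that after_c[of x] betlive[OF c(1), of x] bet(1)[of x] by (force simp: B_def live_def)
          then have "card B \<le> card {q\<in>P. q \<in> between \<and> f q = a}"
            by (intro card_mono) (use fin C(1)[OF c(1)] in \<open>auto simp: B_def\<close>)
          then show ?thesis using betcard by (simp add: M_def)
        qed
        define V where "V = (\<Union>i<k. S i)"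
        have finV: "finite V" using finS by (auto simp: V_def)
        have sub: "(V - B) \<union> M \<subseteq> (\<Union>i<k. S' i)"
        proof
          fix x assume "x \<in> (V - B) \<union> M"
          then consider "x \<in> M" | i where "i < k" "x \<in> S i" "x \<notin> B" by (auto simp: V_def)
          then show "x \<in> (\<Union>i<k. S' i)"
          proof cases
            case 1
            then have "x \<in> S' c" by (auto simp: S'_def newc_def)
            then show ?thesis using c by blast
          next
            case 2
            have tri: "x < p \<or> x = p \<or> x \<in> between \<or> x \<in> late" by (auto simp: late_def)
            have "x \<in> S' c \<or> x \<in> S' D \<or> x \<in> S' i"
              using 2 tri by (auto simp: S'_def newc_def newD_def B_def)
            then show ?thesis using c D 2 by blast
          qed
        qed
        have "V \<inter> M = {}" using Mout by (auto simp: V_def)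
        moreover have "B \<subseteq> V" using c by (auto simp: V_def B_def)
        ultimately have "card V \<le> card ((V - B) \<union> M)"
          using BM finV finM card_mono[OF finV \<open>B \<subseteq> V\<close>]
          by (subst card_Un_disjoint) (auto simp: card_Diff_subset finite_subset)
        also have "\<dots> \<le> card (\<Union>i<k. S' i)"
          by (rule card_mono[OF _ sub])
             (use chain_familyD(1)[OF 1] fin in \<open>auto intro: finite_subset\<close>)
        finally show ?thesis using family_size_UN[OF fin S] family_size_UN[OF fin 1] by (simp add: V_def)
      qed
      with 1 show ?thesis by blast
    qed
  qed
qed

section \<open>Greene numbers under crystal operators\<close>

definition active :: "nat list \<Rightarrow> nat set \<Rightarrow> nat set" where
  "active w A = {p. p < length w \<and> w ! p \<in> A}"

text \<open>The Greene number of the subword with letters in \<open>A\<close>. Positions are masked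
  rather than deleted, so that one letter change can be followed in several alphabets at
  once.\<close>

definition greene_on :: "nat list \<Rightarrow> nat set \<Rightarrow> nat \<Rightarrow> nat" where
  "greene_on w A k = Max {family_size k S | S. chain_family ((!) w) (active w A) k S}"

lemma finite_active [simp]: "finite (active w A)"
  by (simp add: active_def)

lemma finite_family_sizes: "finite {family_size k S | S. chain_family ((!) w) (active w A) k S}"
  by (rule finite_subset[of _ "{..card (active w A)}"]) (auto intro: family_size_le)

lemma greene_on_ge:
  assumes "chain_family ((!) w) (active w A) k S"
  shows "family_size k S \<le> greene_on w A k"
  unfolding greene_on_def by (rule Max_ge[OF finite_family_sizes]) (use assms in blast)

lemma greene_on_obtain:
  obtains S where "chain_family ((!) w) (active w A) k S" "family_size k S = greene_on w A k"
proof -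
  have "chain_family ((!) w) (active w A) k (\<lambda>_. {})"
    by (simp add: chain_family_def)
  then have "{family_size k S | S. chain_family ((!) w) (active w A) k S} \<noteq> {}" by blast
  from Max_in[OF finite_family_sizes this] show thesis
    using that unfolding greene_on_def by auto
qed

lemma greene_on_leI:
  assumes "\<And>S. chain_family ((!) w) (active w A) k S \<Longrightarrow>
             \<exists>S'. chain_family ((!) w') (active w' A') k S' \<and> family_size k S \<le> family_size k S'"
  shows "greene_on w A k \<le> greene_on w' A' k"
  by (metis assms greene_on_obtain greene_on_ge order_trans)

lemma greene_on_mono_positions:
  assumes "active w A \<subseteq> active w' A'"
    and "\<And>x y. x \<in> active w A \<Longrightarrow> y \<in> active w A \<Longrightarrow> w ! x \<le> w ! y \<Longrightarrow> w' ! x \<le> w' ! y"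
  shows "greene_on w A k \<le> greene_on w' A' k"
proof (rule greene_on_leI)
  fix S assume S: "chain_family ((!) w) (active w A) k S"
  have "chain_family ((!) w') (active w' A') k (\<lambda>i. (\<lambda>x. x) ` S i)"
    by (rule chain_family_transfer(1)[OF S]) (use assms in auto)
  then show "\<exists>S'. chain_family ((!) w') (active w' A') k S' \<and> family_size k S \<le> family_size k S'"
    by auto
qed

lemma greene_eq_greene_on:
  assumes "set w \<subseteq> A"
  shows "greene w k = greene_on w A k"
proof -
  have "active w A = {..<length w}" using assms by (auto simp: active_def)
  then show ?thesis
    unfolding greene_def greene_on_def family_size_def chain_family_def weakly_incr_subseq_def
    by (intro arg_cong[where f = Max] Collect_cong ex_cong) auto
qed

text \<open>Reading \<open>a\<close> as an up step and \<open>Suc a\<close> as a down step; a position is unmatched in the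
  crystal bracketing when it realises a record of this walk.\<close>

definition walk_height :: "nat \<Rightarrow> nat list \<Rightarrow> nat \<Rightarrow> int" where
  "walk_height a w q = (\<Sum>p<q. if w ! p = a then 1 else if w ! p = Suc a then - 1 else 0)"

lemma walk_height_0 [simp]: "walk_height a w 0 = 0"
  by (simp add: walk_height_def)

lemma walk_height_Suc:
  "walk_height a w (Suc q) = walk_height a w q + (if w ! q = a then 1 else if w ! q = Suc a then - 1 else 0)"
  by (simp add: walk_height_def)

lemma walk_height_diff:
  assumes "q \<le> r"
  shows "walk_height a w r = walk_height a w q + int (card {p. q \<le> p \<and> p < r \<and> w ! p = a})
           - int (card {p. q \<le> p \<and> p < r \<and> w ! p = Suc a})"
  using assms
proof (induction r rule: dec_induct)
  case base
  have none: "{p. q \<le> p \<and> p < q \<and> P p} = {}" for P by auto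
  show ?case unfolding none by simp
next
  case (step r)
  have *: "{p. q \<le> p \<and> p < Suc r \<and> P p} = (if P r then insert r {p. q \<le> p \<and> p < r \<and> P p} else {p. q \<le> p \<and> p < r \<and> P p})" for P
    using step.hyps by (auto simp: less_Suc_eq)
  show ?case using step.IH unfolding walk_height_Suc *[of "\<lambda>p. w ! p = a"] *[of "\<lambda>p. w ! p = Suc a"]
    by simp
qed

text \<open>\<open>Suc p\<close> is the first time at which the walk attains its overall maximum, so
  \<open>p\<close> is the rightmost unmatched \<open>a\<close>, the letter changed by the crystal
  operator usually called f_a. The condition to the right of \<open>p\<close> is the domination
  hypothesis of \<open>chain_family_raise\<close>; the one to the left becomes it after
  reversal.\<close>

definition raises :: "nat \<Rightarrow> nat list \<Rightarrow> nat \<Rightarrow> bool" where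
  "raises a w p \<longleftrightarrow> p < length w \<and> w ! p = a \<and> (\<forall>q\<le>p. walk_height a w q \<le> walk_height a w p) \<and>
     (\<forall>r. p < r \<longrightarrow> r \<le> length w \<longrightarrow> walk_height a w r \<le> walk_height a w (Suc p))"

lemma active_update:
  assumes "a \<in> A" "Suc a \<in> A" "w ! p = a"
  shows "active (w[p := Suc a]) A = active w A"
  using assms by (cases "p < length w") (auto simp: active_def nth_list_update list_update_beyond)

lemma greene_on_raise_ge:
  assumes r: "raises a w p" and A: "a \<in> A" "Suc a \<in> A"
  shows "greene_on w A k \<le> greene_on (w[p := Suc a]) A k"
proof (rule greene_on_leI)
  fix S assume S: "chain_family ((!) w) (active w A) k S"
  let ?P = "active w A"
  have p: "p < length w" "w ! p = a" using r by (auto simp: raises_def)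
  have key: "card {q\<in>?P. p < q \<and> q < s \<and> w ! q = a} \<le> card {q\<in>?P. p < q \<and> q < s \<and> w ! q = Suc a}"
    if "p < s" "s \<le> length w" for s
  proof -
    have "{q\<in>?P. p < q \<and> q < s \<and> w ! q = b} = {q. Suc p \<le> q \<and> q < s \<and> w ! q = b}" if "b \<in> A" for b
      using that \<open>s \<le> length w\<close> by (auto simp: active_def)
    moreover have "walk_height a w s \<le> walk_height a w (Suc p)" using that r by (simp add: raises_def)
    ultimately show ?thesis
      using walk_height_diff[of "Suc p" s a w] that A by (simp add: Suc_le_eq)
  qed
  have all: "{q\<in>?P. p < q \<and> w ! q = b} = {q\<in>?P. p < q \<and> q < length w \<and> w ! q = b}" for b
    by (auto simp: active_def)
  have "\<exists>S'. chain_family (((!) w)(p := Suc a)) ?P k S' \<and> family_size k S \<le> family_size k S'"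
  proof (rule chain_family_raise[OF _ _ _ _ _ _ _ S])
    show "card {q\<in>?P. p < q \<and> q < s \<and> w ! q = a} \<le> card {q\<in>?P. p < q \<and> q < s \<and> w ! q = Suc a}" for s
    proof (cases "p < s")
      case True
      have "{q\<in>?P. p < q \<and> q < s \<and> w ! q = b} = {q\<in>?P. p < q \<and> q < min s (length w) \<and> w ! q = b}" for b
        by (auto simp: active_def)
      then show ?thesis using key[of "min s (length w)"] p True by simp
    next
      case False
      then have "{q\<in>?P. p < q \<and> q < s \<and> w ! q = b} = {}" for b by auto
      note none = this
      show ?thesis unfolding none by simp
    qed
    show "card {q\<in>?P. p < q \<and> w ! q = a} \<le> card {q\<in>?P. p < q \<and> w ! q = Suc a}"
      unfolding all using key p by simp
  qed (use p A in \<open>auto simp: active_def\<close>)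
  moreover have "chain_family (((!) w)(p := Suc a)) ?P k S' \<longleftrightarrow> chain_family ((!) (w[p := Suc a])) ?P k S'" for S'
  proof -
    have "((!) w)(p := Suc a) = (!) (w[p := Suc a])" using p by (auto simp: nth_list_update)
    then show ?thesis by simp
  qed
  ultimately show "\<exists>S'. chain_family ((!) (w[p := Suc a])) (active (w[p := Suc a]) A) k S' \<and>
      family_size k S \<le> family_size k S'"
    using active_update[OF A p(2)] by simp
qed

text \<open>Reversing the word and the alphabet exchanges raising and lowering.\<close>

lemma greene_on_raise_le:
  assumes r: "raises a w p" and A: "a \<in> A" "Suc a \<in> A"
  shows "greene_on (w[p := Suc a]) A k \<le> greene_on w A k"
proof (rule greene_on_leI)
  define w' where "w' = w[p := Suc a]"
  fix S assume "chain_family ((!) (w[p := Suc a])) (active (w[p := Suc a]) A) k S"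
  let ?P = "active w A"
  have p: "p < length w" "w ! p = a" using r by (auto simp: raises_def)
  have S: "chain_family ((!) w') ?P k S"
    using \<open>chain_family _ _ _ S\<close> active_update[OF A p(2)] by (simp add: w'_def)
  \<comment> \<open>With positions and letters negated, undoing the change at \<open>p\<close> again
    moves a value up, from \<open>- Suc a\<close> to \<open>- a\<close>, so
    \<open>chain_family_raise\<close> applies once more.\<close>
  define f where "f = (\<lambda>y::int. - int (w' ! nat (- y)))"
  define P where "P = (\<lambda>x. - int x) ` ?P"
  have S1: "chain_family f P k (\<lambda>i. (\<lambda>x. - int x) ` S i)" "family_size k (\<lambda>i. (\<lambda>x. - int x) ` S i) = family_size k S"
    using chain_family_transfer[OF S, of "\<lambda>x. - int x" P f] by (auto simp: P_def f_def inj_on_def)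
  have count: "card {q\<in>P. - int p < q \<and> R q \<and> f q = - int b} = card {x. x < p \<and> R (- int x) \<and> w ! x = b}"
    if "b \<in> A" for b R
  proof -
    have "{q\<in>P. - int p < q \<and> R q \<and> f q = - int b} = (\<lambda>x. - int x) ` {x. x < p \<and> R (- int x) \<and> w ! x = b}"
      using p that by (auto simp: P_def f_def w'_def active_def image_iff nth_list_update)
    then show ?thesis by (simp add: card_image inj_on_def)
  qed
  have key: "card {x. x < p \<and> s \<le> x \<and> w ! x = Suc a} \<le> card {x. x < p \<and> s \<le> x \<and> w ! x = a}" for s
  proof (cases "s \<le> p")
    case True
    have "{x. x < p \<and> s \<le> x \<and> w ! x = b} = {x. s \<le> x \<and> x < p \<and> w ! x = b}" for b by auto
    moreover have "walk_height a w s \<le> walk_height a w p" using True r by (simp add: raises_def)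
    ultimately show ?thesis using walk_height_diff[OF True, of a w] by simp
  next
    case False
    then have "{x. x < p \<and> s \<le> x \<and> w ! x = b} = {}" for b by auto
    note none = this
    show ?thesis unfolding none by simp
  qed
  have "\<exists>S'. chain_family (f(- int p := - int a)) P k S' \<and>
      family_size k (\<lambda>i. (\<lambda>x. - int x) ` S i) \<le> family_size k S'"
  proof (rule chain_family_raise[where p = "- int p" and a = "- int (Suc a)" and b = "- int a", OF _ _ _ _ _ _ _ S1(1)])
    show "card {q\<in>P. - int p < q \<and> q < s \<and> f q = - int (Suc a)} \<le> card {q\<in>P. - int p < q \<and> q < s \<and> f q = - int a}" for s
    proof -
      have "- int x < s \<longleftrightarrow> nat (1 - s) \<le> x" if "s \<le> 0" for x using that by auto
      moreover have "- int x < s \<longleftrightarrow> 0 \<le> x" if "\<not> s \<le> 0" for x using that by auto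
      ultimately show ?thesis
        unfolding count[OF A(1), of "\<lambda>q. q < s"] count[OF A(2), of "\<lambda>q. q < s"]
        using key[of "nat (1 - s)"] key[of 0] by (cases "s \<le> 0") simp_all
    qed
    show "card {q\<in>P. - int p < q \<and> f q = - int (Suc a)} \<le> card {q\<in>P. - int p < q \<and> f q = - int a}"
      using count[OF A(1), of "\<lambda>_. True"] count[OF A(2), of "\<lambda>_. True"] key[of 0] by simp
    show "f q \<le> - int (Suc a) \<or> - int a \<le> f q" if "q \<in> P" for q by (auto simp: f_def)
  qed (use p A in \<open>auto simp: P_def f_def w'_def active_def\<close>)
  then obtain S2 where S2: "chain_family (f(- int p := - int a)) P k S2" "family_size k S \<le> family_size k S2"
    using S1(2) by auto
  have undo: "(f(- int p := - int a)) (- int x) = - int (w ! x)" for x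
    using p by (auto simp: f_def w'_def nth_list_update)
  have "chain_family ((!) w) ?P k (\<lambda>i. (\<lambda>y. nat (- y)) ` S2 i)" "family_size k (\<lambda>i. (\<lambda>y. nat (- y)) ` S2 i) = family_size k S2"
  proof -
    have "(x < y \<and> ((f(- int p := - int a)) x \<le> (f(- int p := - int a)) y \<longrightarrow> w ! nat (- x) \<le> w ! nat (- y))) \<or>
          (y < x \<and> ((f(- int p := - int a)) y \<le> (f(- int p := - int a)) x \<longrightarrow> w ! nat (- x) \<le> w ! nat (- y)))"
      if "x \<in> P" "y \<in> P" "nat (- x) < nat (- y)" for x y
    proof -
      from that obtain u v where "x = - int u" "y = - int v" "u < v" by (auto simp: P_def)
      then show ?thesis using undo[of u] undo[of v] by simp
    qed
    note tr = chain_family_transfer[where \<phi> = "\<lambda>y. nat (- y)" and f' = "(!) w" and P' = ?P, OF S2(1) _ _ this]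
    show "chain_family ((!) w) ?P k (\<lambda>i. (\<lambda>y. nat (- y)) ` S2 i)" "family_size k (\<lambda>i. (\<lambda>y. nat (- y)) ` S2 i) = family_size k S2"
      by (rule tr; auto simp: P_def inj_on_def)+
  qed
  then show "\<exists>S'. chain_family ((!) w) ?P k S' \<and> family_size k S \<le> family_size k S'"
    using S2(2) by metis
qed

lemma greene_on_raise:
  assumes "raises a w p" "a \<in> A" "Suc a \<in> A"
  shows "greene_on (w[p := Suc a]) A k = greene_on w A k"
  using greene_on_raise_ge[OF assms] greene_on_raise_le[OF assms] by (rule antisym[rotated])

text \<open>A walk that is highest at its end means that every suffix has at least as many
  \<open>a\<close> as \<open>Suc a\<close>, that is, no \<open>Suc a\<close> is unmatched: these are
  the reverse lattice words, the highest weight words of the crystal.\<close>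

definition yamanouchi :: "nat set \<Rightarrow> nat list \<Rightarrow> bool" where
  "yamanouchi A w \<longleftrightarrow> (\<forall>a q. a \<in> A \<longrightarrow> Suc a \<in> A \<longrightarrow> q \<le> length w \<longrightarrow> walk_height a w q \<le> walk_height a w (length w))"

lemma yamanouchi_suffix:
  assumes "yamanouchi {lo..<hi} w" "s \<le> length w" "lo \<le> l" "l \<le> l'" "l' < hi"
  shows "card {q. s \<le> q \<and> q < length w \<and> w ! q = l'} \<le> card {q. s \<le> q \<and> q < length w \<and> w ! q = l}"
  using assms(4,5)
proof (induction l' rule: dec_induct)
  case (step l')
  have "walk_height l' w s \<le> walk_height l' w (length w)" 
    using assms(1,2,3) step unfolding yamanouchi_def by simp
  then show ?case using walk_height_diff[OF assms(2), of l' w] step by simp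
qed simp

text \<open>For the lower bound, each class of equal letters is a chain. For the upper bound,
  \<open>j\<close> chains meet each strictly decreasing class of \<open>col\<close> in at most
  \<open>j\<close> positions and in no more than its size; summing the smaller of the two bounds
  gives the number of letters below \<open>lo + j\<close>.\<close>

lemma greene_on_yamanouchi:
  assumes yam: "yamanouchi {lo..<hi} w" and j: "lo + j \<le> hi"
  shows "greene_on w {lo..<hi} j = card {p. p < length w \<and> lo \<le> w ! p \<and> w ! p < lo + j}"
proof (rule antisym)
  let ?n = "length w" and ?A = "{lo..<hi}"
  define N where "N = (\<lambda>l s. card {q. s \<le> q \<and> q < ?n \<and> w ! q = l})"
  \<comment> \<open>Numbering equal letters from the right, equal values of \<open>col\<close> form a strictly decreasing
    subsequence of the word, which a weakly increasing one meets at most once.\<close>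
  define col where "col = (\<lambda>p. N (w ! p) p)"
  have N_step: "N l y < N l x" if "x < y" "x < ?n" "w ! x = l" for l x y
  proof -
    have "x \<in> {q. x \<le> q \<and> q < ?n \<and> w ! q = l}" "x \<notin> {q. y \<le> q \<and> q < ?n \<and> w ! q = l}"
      using that by auto
    moreover have "{q. y \<le> q \<and> q < ?n \<and> w ! q = l} \<subseteq> {q. x \<le> q \<and> q < ?n \<and> w ! q = l}"
      using that(1) by (auto intro: order_trans)
    ultimately show ?thesis
      unfolding N_def by (intro psubset_card_mono) auto
  qed
  have N_anti: "N l' s \<le> N l s" if "s \<le> ?n" "lo \<le> l" "l \<le> l'" "l' < hi" for l l' s
    unfolding N_def by (rule yamanouchi_suffix[OF yam that])
  obtain S where S: "chain_family ((!) w) (active w ?A) j S" "family_size j S = greene_on w ?A j"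
    by (rule greene_on_obtain)
  note C = chain_familyD[OF S(1)]
  have col_less: "col y < col x" if "i < j" "x \<in> S i" "y \<in> S i" "x < y" for i x y
  proof -
    have xy: "x < ?n" "y < ?n" "w ! x \<in> ?A" "w ! y \<in> ?A" using C(1)[OF that(1)] that by (auto simp: active_def)
    have "N (w ! y) y \<le> N (w ! x) y" by (rule N_anti) (use xy C(2)[OF that] in auto)
    also have "\<dots> < N (w ! x) x" by (rule N_step) (use xy that in auto)
    finally show ?thesis by (simp add: col_def)
  qed
  define V where "V = (\<Union>i<j. S i)"
  have VA: "V \<subseteq> active w ?A" using C(1) by (auto simp: V_def)
  then have finV: "finite V" by (rule finite_subset) simp
  have N0: "N (w ! p) p \<le> N (w ! p) 0" "N (w ! p) 0 \<le> ?n" "0 < N (w ! p) p" if "p < ?n" for p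
  proof -
    show "N (w ! p) p \<le> N (w ! p) 0" unfolding N_def by (rule card_mono) auto
    have "N (w ! p) 0 \<le> card {..<?n}" unfolding N_def by (rule card_mono) auto
    then show "N (w ! p) 0 \<le> ?n" by simp
    show "0 < N (w ! p) p" unfolding N_def using that by (auto simp: card_gt_0_iff)
  qed
  have col_range: "col ` V \<subseteq> {1..?n}"
    using VA N0 by (force simp: col_def active_def Suc_le_eq)
  have "greene_on w ?A j = card V" using S(2) family_size_UN[OF finite_active S(1)] by (simp add: V_def)
  also have "\<dots> = (\<Sum>r\<in>{1..?n}. card {p\<in>V. col p = r})"
  proof -
    have "card V = card (\<Union>r\<in>{1..?n}. {p\<in>V. col p = r})"
      by (rule arg_cong[where f = card]) (use col_range in auto)
    also have "\<dots> = (\<Sum>r\<in>{1..?n}. card {p\<in>V. col p = r})"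
      by (rule card_UN_disjoint) (use finV in auto)
    finally show ?thesis .
  qed
  also have "\<dots> \<le> (\<Sum>r\<in>{1..?n}. card {l\<in>{lo..<lo+j}. r \<le> N l 0})"
  proof (rule sum_mono)
    fix r assume r: "r \<in> {1..?n}"
    let ?V = "{p\<in>V. col p = r}"
    show "card ?V \<le> card {l\<in>{lo..<lo+j}. r \<le> N l 0}"
    \<comment> \<open>The letters occurring at least \<open>r\<close> times form an initial segment
      of the alphabet. If it contains the first \<open>j\<close> letters, the number of chains is
      the better bound; otherwise it lies inside them, and the distinct letters of the class are
      counted.\<close>
    proof (cases "\<forall>l\<in>{lo..<lo+j}. r \<le> N l 0")
      case True
      have "\<forall>p\<in>?V. \<exists>i. i < j \<and> p \<in> S i" by (auto simp: V_def)
      then obtain g where g: "\<And>p. p \<in> ?V \<Longrightarrow> g p < j \<and> p \<in> S (g p)" by metis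
      have "inj_on g ?V"
        by (rule inj_onI) (metis (mono_tags, lifting) CollectD col_less g less_irrefl linorder_neqE_nat)
      then have "card ?V \<le> card {..<j}" by (rule card_inj_on_le) (use g in auto)
      also have "{l\<in>{lo..<lo+j}. r \<le> N l 0} = {lo..<lo+j}" using True by auto
      then have "card {..<j} = card {l\<in>{lo..<lo+j}. r \<le> N l 0}" by simp
      finally show ?thesis .
    next
      case False
      then obtain l0 where l0: "lo \<le> l0" "l0 < lo + j" "N l0 0 < r" by auto
      show ?thesis
      proof (rule card_inj_on_le[of "(!) w"])
        show "inj_on ((!) w) ?V"
        proof (rule inj_onI)
          fix x y assume xy: "x \<in> ?V" "y \<in> ?V" "w ! x = w ! y"
          then have "x < ?n" "y < ?n" using VA by (auto simp: active_def)
          with xy N_step[of x y] N_step[of y x] show "x = y"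
            by (auto simp: col_def) (metis less_irrefl linorder_neqE_nat)
        qed
        show "(!) w ` ?V \<subseteq> {l\<in>{lo..<lo+j}. r \<le> N l 0}"
        proof (rule image_subsetI)
          fix x assume x: "x \<in> ?V"
          then have xa: "x < ?n" "lo \<le> w ! x" "w ! x < hi" using VA by (auto simp: active_def)
          have "r \<le> N (w ! x) 0" using x N0(1)[OF xa(1)] by (simp add: col_def)
          moreover from this have "w ! x < l0"
            using N_anti[of 0 l0 "w ! x"] l0 xa by (cases "w ! x < l0") auto
          ultimately show "w ! x \<in> {l\<in>{lo..<lo+j}. r \<le> N l 0}" using xa l0 by auto
        qed
      qed simp
    qed
  qed
  also have "\<dots> = (\<Sum>r\<in>{1..?n}. \<Sum>l\<in>{lo..<lo+j}. if r \<le> N l 0 then 1 else 0)"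
    by (intro sum.cong refl) (simp add: sum.If_cases Int_def)
  also have "\<dots> = (\<Sum>l\<in>{lo..<lo+j}. \<Sum>r\<in>{1..?n}. if r \<le> N l 0 then 1 else 0)"
    by (rule sum.swap)
  also have "\<dots> = (\<Sum>l\<in>{lo..<lo+j}. N l 0)"
  proof (intro sum.cong refl)
    fix l
    have "N l 0 \<le> card {..<?n}" unfolding N_def by (rule card_mono) auto
    then have "{r. r \<in> {1..?n} \<and> r \<le> N l 0} = {1..N l 0}" by auto
    then show "(\<Sum>r\<in>{1..?n}. if r \<le> N l 0 then 1 else 0) = N l 0"
      by (simp add: sum.If_cases Int_def)
  qed
  also have "\<dots> = card (\<Union>l\<in>{lo..<lo+j}. {q. 0 \<le> q \<and> q < ?n \<and> w ! q = l})"
    unfolding N_def by (rule card_UN_disjoint[symmetric]) auto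
  also have "(\<Union>l\<in>{lo..<lo+j}. {q. 0 \<le> q \<and> q < ?n \<and> w ! q = l}) = {p. p < ?n \<and> lo \<le> w ! p \<and> w ! p < lo + j}"
    by auto
  finally show "greene_on w ?A j \<le> card {p. p < ?n \<and> lo \<le> w ! p \<and> w ! p < lo + j}" .
next
  let ?n = "length w"
  define S where "S = (\<lambda>i. {p. p < ?n \<and> w ! p = lo + i})"
  have S: "chain_family ((!) w) (active w {lo..<hi}) j S"
    using j by (auto simp: chain_family_def S_def active_def)
  have "(\<Union>i<j. S i) = {p. p < ?n \<and> lo \<le> w ! p \<and> w ! p < lo + j}"
    by (auto simp: S_def dest: le_Suc_ex)
  then show "card {p. p < ?n \<and> lo \<le> w ! p \<and> w ! p < lo + j} \<le> greene_on w {lo..<hi} j"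
    using greene_on_ge[OF S] family_size_UN[OF finite_active S] by simp
qed

section \<open>Reflections of a prefix\<close>

text \<open>The analogue of \<open>raises\<close> for the prefix of length \<open>m\<close> and for
  both directions: with \<open>c = a\<close> the rightmost unmatched \<open>a\<close>, with
  \<open>c = Suc a\<close> the leftmost unmatched \<open>Suc a\<close>.\<close>

definition record_step :: "nat \<Rightarrow> nat \<Rightarrow> nat list \<Rightarrow> nat \<Rightarrow> nat \<Rightarrow> bool" where
  "record_step a m w c p \<longleftrightarrow> p < m \<and> w ! p = c \<and> (\<forall>q\<le>p. walk_height a w q \<le> walk_height a w p) \<and>
     (\<forall>r. p < r \<longrightarrow> r \<le> m \<longrightarrow> walk_height a w r \<le> walk_height a w (Suc p))"

text \<open>The walk starts at 0, so the peak counts the unmatched \<open>a\<close>s of the prefix,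
  and the peak minus the height at \<open>m\<close> counts its unmatched
  \<open>Suc a\<close>s.\<close>

definition peak :: "nat \<Rightarrow> nat \<Rightarrow> nat list \<Rightarrow> int" where
  "peak a m w = Max (walk_height a w ` {..m})"

lemma peak_ge: "q \<le> m \<Longrightarrow> walk_height a w q \<le> peak a m w"
  unfolding peak_def by (rule Max_ge) auto

lemma peak_attained: "\<exists>q\<le>m. walk_height a w q = peak a m w"
proof -
  have "peak a m w \<in> walk_height a w ` {..m}" unfolding peak_def by (rule Max_in) auto
  then show ?thesis by auto
qed

lemma peak_eqI:
  assumes "q \<le> m" "walk_height a w q = h" "\<And>r. r \<le> m \<Longrightarrow> walk_height a w r \<le> h"
  shows "peak a m w = h"
  unfolding peak_def by (rule Max_eqI) (use assms in auto)

text \<open>The record is the step into the first visit to the peak.\<close>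

lemma ex_up_record:
  assumes "0 < peak a m w"
  shows "\<exists>p. record_step a m w a p"
proof -
  define q where "q = (LEAST q. q \<le> m \<and> walk_height a w q = peak a m w)"
  have q: "q \<le> m" "walk_height a w q = peak a m w"
    using LeastI_ex[OF peak_attained[of m a w]] by (auto simp: q_def)
  have min: "walk_height a w r < peak a m w" if "r < q" for r
    using not_less_Least[OF that[unfolded q_def]] peak_ge[of r m a w] q(1) that by force
  from q assms obtain p where p: "q = Suc p" by (cases q) auto
  have "w ! p = a"
    using min[of p] q p by (auto simp: walk_height_Suc split: if_splits)
  moreover from this have "walk_height a w q = walk_height a w p + 1" by (simp add: p walk_height_Suc)
  then have "walk_height a w r \<le> walk_height a w p" if "r \<le> p" for r
    using min[of r] that q p by simp
  ultimately have "record_step a m w a p"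
    using q p peak_ge[of _ m a w] by (auto simp: record_step_def)
  then show ?thesis by blast
qed

text \<open>The record is the step away from the last visit to the peak.\<close>

lemma ex_down_record:
  assumes "walk_height a w m < peak a m w"
  shows "\<exists>p. record_step a m w (Suc a) p"
proof -
  define p where "p = (GREATEST q. q \<le> m \<and> walk_height a w q = peak a m w)"
  have p: "p \<le> m" "walk_height a w p = peak a m w"
    using GreatestI_ex_nat[OF peak_attained[of m a w], of m] by (auto simp: p_def)
  have max: "walk_height a w r < peak a m w" if "p < r" "r \<le> m" for r
    using Greatest_le_nat[of "\<lambda>q. q \<le> m \<and> walk_height a w q = peak a m w" r m] peak_ge[of r m a w] that
    unfolding p_def by force
  have "p < m" using p assms by (cases "p = m") auto
  then have wp: "w ! p = Suc a"
    using max[of "Suc p"] p by (auto simp: walk_height_Suc split: if_splits)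
  then have "record_step a m w (Suc a) p"
    using p max \<open>p < m\<close> peak_ge[of _ m a w] by (force simp: record_step_def walk_height_Suc)
  then show ?thesis by blast
qed

lemma walk_height_flip_down:
  assumes "p < length w" "w ! p = a"
  shows "walk_height a (w[p := Suc a]) q = walk_height a w q - (if p < q then 2 else 0)"
proof (induction q)
  case (Suc q)
  then show ?case using assms by (cases "q = p") (auto simp: walk_height_Suc)
qed simp

lemma walk_height_flip_up:
  assumes "p < length w" "w ! p = Suc a"
  shows "walk_height a (w[p := a]) q = walk_height a w q + (if p < q then 2 else 0)"
proof (induction q)
  case (Suc q)
  then show ?case using assms by (cases "q = p") (auto simp: walk_height_Suc)
qed simp

lemma record_step_peak:
  assumes "record_step a m w c p" "c = a \<or> c = Suc a"
  shows "peak a m w = walk_height a w p + (if c = a then 1 else 0)"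
proof (rule peak_eqI)
  show "(if c = a then Suc p else p) \<le> m" using assms by (auto simp: record_step_def)
  show "walk_height a w (if c = a then Suc p else p) = walk_height a w p + (if c = a then 1 else 0)"
    using assms by (auto simp: record_step_def walk_height_Suc)
  fix r assume "r \<le> m"
  then show "walk_height a w r \<le> walk_height a w p + (if c = a then 1 else 0)"
  proof (cases "r \<le> p")
    case True
    then have "walk_height a w r \<le> walk_height a w p" using assms(1) by (simp add: record_step_def)
    then show ?thesis by simp
  next
    case False
    then have "walk_height a w r \<le> walk_height a w (Suc p)" "w ! p = c"
      using assms(1) \<open>r \<le> m\<close> by (simp_all add: record_step_def)
    then show ?thesis using assms(2) by (auto simp: walk_height_Suc)
  qed
qed

lemma record_step_unique:
  assumes "record_step a m w c p" "record_step a m w c p'" "c = a \<or> c = Suc a"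
  shows "p = p'"
proof -
  have False if "record_step a m w c p" "record_step a m w c p'" "p < p'" for p p'
  proof -
    have "walk_height a w p \<le> walk_height a w p'" "walk_height a w p' \<le> walk_height a w (Suc p)"
      "walk_height a w (Suc p') \<le> walk_height a w (Suc p)" "walk_height a w (Suc p) \<le> walk_height a w p'"
      "w ! p = c" "w ! p' = c"
      using that by (auto simp: record_step_def)
    then show False using assms(3) by (auto simp: walk_height_Suc)
  qed
  then show ?thesis using assms(1,2) by (meson linorder_neqE_nat)
qed

lemma record_step_flip_down:
  assumes "record_step a m w a p" "m \<le> length w"
  shows "record_step a m (w[p := Suc a]) (Suc a) p"
proof -
  have p: "p < length w" "w ! p = a" using assms by (auto simp: record_step_def)
  show ?thesis using assms p unfolding record_step_def walk_height_flip_down[OF p] by auto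
qed

lemma record_step_flip_up:
  assumes "record_step a m w (Suc a) p" "m \<le> length w"
  shows "record_step a m (w[p := a]) a p"
proof -
  have p: "p < length w" "w ! p = Suc a" using assms by (auto simp: record_step_def)
  show ?thesis using assms p unfolding record_step_def walk_height_flip_up[OF p] by auto
qed

definition flip_down :: "nat \<Rightarrow> nat \<Rightarrow> nat list \<Rightarrow> nat list" where
  "flip_down a m w = w[(SOME p. record_step a m w a p) := Suc a]"

definition flip_up :: "nat \<Rightarrow> nat \<Rightarrow> nat list \<Rightarrow> nat list" where
  "flip_up a m w = w[(SOME p. record_step a m w (Suc a) p) := a]"

lemma flip_down_eq: "record_step a m w a p \<Longrightarrow> flip_down a m w = w[p := Suc a]"
  unfolding flip_down_def by (metis record_step_unique someI_ex)

lemma flip_up_eq: "record_step a m w (Suc a) p \<Longrightarrow> flip_up a m w = w[p := a]"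
  unfolding flip_up_def by (metis record_step_unique someI_ex)

lemma flip_down_props:
  assumes "0 < peak a m w" "m \<le> length w"
  shows "peak a m (flip_down a m w) = peak a m w - 1"
    and "walk_height a (flip_down a m w) m = walk_height a w m - 2"
    and "flip_up a m (flip_down a m w) = w"
proof -
  obtain p where p: "record_step a m w a p" using ex_up_record[OF assms(1)] by blast
  then have p': "p < m" "p < length w" "w ! p = a" using assms by (auto simp: record_step_def)
  note r = record_step_flip_down[OF p assms(2)]
  show "peak a m (flip_down a m w) = peak a m w - 1"
    using record_step_peak[OF r] record_step_peak[OF p]
    by (simp add: flip_down_eq[OF p] walk_height_flip_down[OF p'(2,3)])
  show "walk_height a (flip_down a m w) m = walk_height a w m - 2"
    using p' by (simp add: flip_down_eq[OF p] walk_height_flip_down[OF p'(2,3)])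
  show "flip_up a m (flip_down a m w) = w"
    using list_update_id[of w p] p'(3) by (simp add: flip_down_eq[OF p] flip_up_eq[OF r]) 
qed

lemma flip_up_props:
  assumes "walk_height a w m < peak a m w" "m \<le> length w"
  shows "peak a m (flip_up a m w) = peak a m w + 1"
    and "walk_height a (flip_up a m w) m = walk_height a w m + 2"
    and "flip_down a m (flip_up a m w) = w"
proof -
  obtain p where p: "record_step a m w (Suc a) p" using ex_down_record[OF assms(1)] by blast
  then have p': "p < m" "p < length w" "w ! p = Suc a" using assms by (auto simp: record_step_def)
  note r = record_step_flip_up[OF p assms(2)]
  show "peak a m (flip_up a m w) = peak a m w + 1"
    using record_step_peak[OF r] record_step_peak[OF p]
    by (simp add: flip_up_eq[OF p] walk_height_flip_up[OF p'(2,3)])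
  show "walk_height a (flip_up a m w) m = walk_height a w m + 2"
    using p' by (simp add: flip_up_eq[OF p] walk_height_flip_up[OF p'(2,3)])
  show "flip_down a m (flip_up a m w) = w"
    using list_update_id[of w p] p'(3) by (simp add: flip_up_eq[OF p] flip_down_eq[OF r]) 
qed

definition differ_within :: "nat \<Rightarrow> nat \<Rightarrow> nat list \<Rightarrow> nat list \<Rightarrow> bool" where
  "differ_within a m w w' \<longleftrightarrow> length w' = length w \<and>
     (\<forall>p<length w. w' ! p = w ! p \<or> (p < m \<and> w ! p \<in> {a, Suc a} \<and> w' ! p \<in> {a, Suc a}))"

lemma differ_within_refl [simp]: "differ_within a m w w"
  by (simp add: differ_within_def)

lemma differ_within_trans:
  "differ_within a m w w' \<Longrightarrow> differ_within a m w' w'' \<Longrightarrow> differ_within a m w w''"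
  unfolding differ_within_def by metis

lemma raises_of_record_step:
  assumes "record_step a m w a p" "m \<le> length w"
    and "\<And>r. m \<le> r \<Longrightarrow> r \<le> length w \<Longrightarrow> walk_height a w r \<le> walk_height a w m"
  shows "raises a w p"
  unfolding raises_def
proof (intro conjI allI impI)
  fix r assume r: "p < r" "r \<le> length w"
  show "walk_height a w r \<le> walk_height a w (Suc p)"
  proof (cases "r \<le> m")
    case True
    then show ?thesis using assms(1) r by (simp add: record_step_def)
  next
    case False
    then have "walk_height a w r \<le> walk_height a w m" using assms(3) r by simp
    also have "\<dots> \<le> walk_height a w (Suc p)" using assms(1) by (simp add: record_step_def)
    finally show ?thesis .
  qed
qed (use assms in \<open>auto simp: record_step_def\<close>)

lemma walk_height_tail:
  assumes "\<And>p. s \<le> p \<Longrightarrow> p < r \<Longrightarrow> w' ! p = w ! p" "s \<le> r"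
  shows "walk_height b w' r - walk_height b w' s = walk_height b w r - walk_height b w s"
proof -
  have "{p. s \<le> p \<and> p < r \<and> w' ! p = c} = {p. s \<le> p \<and> p < r \<and> w ! p = c}" for c
    using assms(1) by auto
  then show ?thesis using walk_height_diff[OF assms(2)] by simp
qed

text \<open>The premise keeps the walk after \<open>m\<close> at or below its height at
  \<open>m\<close>. Records of the prefix are then records of the whole word, so flips in the prefix
  are genuine crystal operators. The tail is untouched, hence the premise survives each flip and the
  property composes.\<close>

definition stable :: "nat \<Rightarrow> nat \<Rightarrow> nat list \<Rightarrow> nat list \<Rightarrow> bool" where
  "stable a m w w' \<longleftrightarrow> differ_within a m w w' \<and>
     ((\<forall>r. m \<le> r \<longrightarrow> r \<le> length w \<longrightarrow> walk_height a w r \<le> walk_height a w m) \<longrightarrow>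
      (\<forall>A k. a \<in> A \<longrightarrow> Suc a \<in> A \<longrightarrow> greene_on w' A k = greene_on w A k))"

lemma differ_within_tail:
  assumes "differ_within a m w w'" "m \<le> s" "s \<le> r" "r \<le> length w"
  shows "walk_height b w' r - walk_height b w' s = walk_height b w r - walk_height b w s"
proof (rule walk_height_tail)
  fix p assume "s \<le> p" "p < r"
  then have "p < length w" "\<not> p < m" using assms by auto
  then show "w' ! p = w ! p" using assms(1) by (auto simp: differ_within_def)
qed (rule assms(3))

lemma stable_trans:
  assumes "stable a m w w'" "stable a m w' w''" "m \<le> length w"
  shows "stable a m w w''"
proof -
  have "walk_height a w' r - walk_height a w' m = walk_height a w r - walk_height a w m"
    if "m \<le> r" "r \<le> length w" for r
    using differ_within_tail[of a m w w' m r a] assms(1) that by (simp add: stable_def)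
  moreover have "length w' = length w" using assms(1) by (simp add: stable_def differ_within_def)
  ultimately show ?thesis using assms differ_within_trans unfolding stable_def
    by (smt (verit))
qed

lemma stable_flip_down:
  assumes "0 < peak a m w" "m \<le> length w"
  shows "stable a m w (flip_down a m w)"
proof -
  obtain p where p: "record_step a m w a p" using ex_up_record[OF assms(1)] by blast
  then have p': "p < m" "p < length w" "w ! p = a" using assms by (auto simp: record_step_def)
  show ?thesis
    unfolding stable_def flip_down_eq[OF p]
    using p' greene_on_raise[OF raises_of_record_step[OF p assms(2)]]
    by (auto simp: differ_within_def nth_list_update)
qed

lemma stable_flip_up:
  assumes "walk_height a w m < peak a m w" "m \<le> length w"
  shows "stable a m w (flip_up a m w)"
proof -
  obtain p where p: "record_step a m w (Suc a) p" using ex_down_record[OF assms(1)] by blast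
  then have p': "p < m" "p < length w" "w ! p = Suc a" using assms by (auto simp: record_step_def)
  let ?w = "w[p := a]"
  have r: "record_step a m ?w a p" using record_step_flip_up[OF p assms(2)] .
  have w: "?w[p := Suc a] = w" using p' by (metis list_update_id list_update_overwrite)
  have d: "differ_within a m w ?w" using p' by (auto simp: differ_within_def nth_list_update)
  have "greene_on ?w A k = greene_on w A k"
    if "\<forall>r. m \<le> r \<longrightarrow> r \<le> length w \<longrightarrow> walk_height a w r \<le> walk_height a w m" "a \<in> A" "Suc a \<in> A" for A k
  proof -
    have "raises a ?w p"
      by (rule raises_of_record_step[OF r]) (use assms that(1) p' walk_height_flip_up[OF p'(2,3)] in auto)
    from greene_on_raise[OF this that(2,3), of k] show ?thesis unfolding w by simp
  qed
  then show ?thesis unfolding stable_def flip_up_eq[OF p] using d by blast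
qed

lemma flip_down_iterate:
  assumes "int j \<le> peak a m w" "m \<le> length w"
  shows "peak a m ((flip_down a m ^^ j) w) = peak a m w - int j \<and>
     walk_height a ((flip_down a m ^^ j) w) m = walk_height a w m - 2 * int j \<and>
     (flip_up a m ^^ j) ((flip_down a m ^^ j) w) = w \<and>
     stable a m w ((flip_down a m ^^ j) w)"
  using assms(1)
proof (induction j)
  case 0
  then show ?case by (simp add: stable_def)
next
  case (Suc j)
  let ?v = "(flip_down a m ^^ j) w"
  have IH: "peak a m ?v = peak a m w - int j" "walk_height a ?v m = walk_height a w m - 2 * int j"
    "(flip_up a m ^^ j) ?v = w" "stable a m w ?v"
    using Suc by auto
  have pos: "0 < peak a m ?v" "m \<le> length ?v"
    using IH Suc.prems assms(2) by (auto simp: stable_def differ_within_def)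
  have "stable a m w (flip_down a m ?v)"
    using stable_trans[OF IH(4) stable_flip_down[OF pos] assms(2)] .
  moreover have "(flip_up a m ^^ Suc j) (flip_down a m ?v) = w"
    using flip_down_props(3)[OF pos] IH(3) by (simp add: funpow_swap1)
  ultimately show ?case using flip_down_props[OF pos] IH by (simp add: algebra_simps)
qed

lemma flip_up_iterate:
  assumes "int j \<le> peak a m w - walk_height a w m" "m \<le> length w"
  shows "peak a m ((flip_up a m ^^ j) w) = peak a m w + int j \<and>
     walk_height a ((flip_up a m ^^ j) w) m = walk_height a w m + 2 * int j \<and>
     (flip_down a m ^^ j) ((flip_up a m ^^ j) w) = w \<and>
     stable a m w ((flip_up a m ^^ j) w)"
  using assms(1)
proof (induction j)
  case 0
  then show ?case by (simp add: stable_def)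
next
  case (Suc j)
  let ?v = "(flip_up a m ^^ j) w"
  have IH: "peak a m ?v = peak a m w + int j" "walk_height a ?v m = walk_height a w m + 2 * int j"
    "(flip_down a m ^^ j) ?v = w" "stable a m w ?v"
    using Suc by auto
  have pos: "walk_height a ?v m < peak a m ?v" "m \<le> length ?v"
    using IH Suc.prems assms(2) by (auto simp: stable_def differ_within_def)
  have "stable a m w (flip_up a m ?v)"
    using stable_trans[OF IH(4) stable_flip_up[OF pos] assms(2)] .
  moreover have "(flip_down a m ^^ Suc j) (flip_up a m ?v) = w"
    using flip_up_props(3)[OF pos] IH(3) by (simp add: funpow_swap1)
  ultimately show ?case using flip_up_props[OF pos] IH by (simp add: algebra_simps)
qed

text \<open>The height at \<open>m\<close> is the number of unmatched \<open>a\<close>s minus that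
  of unmatched \<open>Suc a\<close>s; that many flips interchange the two numbers. This is the Weyl
  group (Lascoux-Schuetzenberger) reflection, applied to the prefix only.\<close>

definition reflect :: "nat \<Rightarrow> nat \<Rightarrow> nat list \<Rightarrow> nat list" where
  "reflect a m w = (if 0 \<le> walk_height a w m then (flip_down a m ^^ nat (walk_height a w m)) w
     else (flip_up a m ^^ nat (- walk_height a w m)) w)"

lemma reflect_props:
  assumes "m \<le> length w"
  shows "walk_height a (reflect a m w) m = - walk_height a w m"
    and "stable a m w (reflect a m w)"
    and "reflect a m (reflect a m w) = w"
proof -
  have h: "walk_height a w m \<le> peak a m w" "0 \<le> peak a m w"
    using peak_ge[of m m a w] peak_ge[of 0 m a w] by auto
  have "walk_height a (reflect a m w) m = - walk_height a w m \<and> stable a m w (reflect a m w) \<and>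
     reflect a m (reflect a m w) = w"
  proof (cases "0 \<le> walk_height a w m")
    case True
    let ?j = "nat (walk_height a w m)" 
    note it = flip_down_iterate[of ?j a m w]
    have r: "reflect a m w = (flip_down a m ^^ ?j) w" using True by (simp add: reflect_def)
    have hr: "walk_height a (reflect a m w) m = - walk_height a w m" using it h assms True r by simp
    have "reflect a m (reflect a m w) = (flip_up a m ^^ ?j) (reflect a m w)"
      using hr True unfolding reflect_def[of a m "reflect a m w"] by auto
    then show ?thesis using hr it h assms True r by simp
  next
    case False
    let ?j = "nat (- walk_height a w m)"
    note it = flip_up_iterate[of ?j a m w]
    have r: "reflect a m w = (flip_up a m ^^ ?j) w" using False by (simp add: reflect_def)
    have hr: "walk_height a (reflect a m w) m = - walk_height a w m" using it h assms False r by simp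
    have "reflect a m (reflect a m w) = (flip_down a m ^^ ?j) (reflect a m w)"
      using hr False unfolding reflect_def[of a m "reflect a m w"] by auto
    then show ?thesis using hr it h assms False r by simp
  qed
  then show "walk_height a (reflect a m w) m = - walk_height a w m" "stable a m w (reflect a m w)"
    "reflect a m (reflect a m w) = w" by blast+
qed

lemma count_list_card: "count_list w l = card {p. p < length w \<and> w ! p = l}"
  by (simp add: count_list_eq_length_filter length_filter_conv_card eq_commute)

lemma differ_within_counts:
  assumes "differ_within a m w w'" "m \<le> length w"
  shows "l \<noteq> a \<Longrightarrow> l \<noteq> Suc a \<Longrightarrow> count_list w' l = count_list w l"
    and "count_list w' a + count_list w' (Suc a) = count_list w a + count_list w (Suc a)"
    and "set w \<subseteq> B \<Longrightarrow> a \<in> B \<Longrightarrow> Suc a \<in> B \<Longrightarrow> set w' \<subseteq> B"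
proof -
  have len: "length w' = length w" using assms(1) by (simp add: differ_within_def)
  show "count_list w' l = count_list w l" if "l \<noteq> a" "l \<noteq> Suc a"
  proof -
    have "{p. p < length w' \<and> w' ! p = l} = {p. p < length w \<and> w ! p = l}"
      using assms(1) that unfolding differ_within_def by auto
    then show ?thesis by (simp add: count_list_card)
  qed
  have "count_list v a + count_list v (Suc a) = card {p. p < length v \<and> v ! p \<in> {a, Suc a}}" for v
  proof -
    have "{p. p < length v \<and> v ! p \<in> {a, Suc a}} = {p. p < length v \<and> v ! p = a} \<union> {p. p < length v \<and> v ! p = Suc a}" by auto
    moreover have "card \<dots> = card {p. p < length v \<and> v ! p = a} + card {p. p < length v \<and> v ! p = Suc a}"
      by (rule card_Un_disjoint) auto
    ultimately show ?thesis unfolding count_list_card by simp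
  qed
  moreover have "{p. p < length w' \<and> w' ! p \<in> {a, Suc a}} = {p. p < length w \<and> w ! p \<in> {a, Suc a}}"
  proof (rule Collect_cong)
    fix p
    show "p < length w' \<and> w' ! p \<in> {a, Suc a} \<longleftrightarrow> p < length w \<and> w ! p \<in> {a, Suc a}"
      using assms(1) unfolding differ_within_def by metis
  qed
  ultimately show "count_list w' a + count_list w' (Suc a) = count_list w a + count_list w (Suc a)" by simp
  show "set w' \<subseteq> B" if "set w \<subseteq> B" "a \<in> B" "Suc a \<in> B"
  proof
    fix l assume "l \<in> set w'"
    then obtain p where p: "p < length w" "w' ! p = l" using len by (auto simp: in_set_conv_nth)
    then have "w ! p \<in> B" using that(1) nth_mem by blast
    moreover have "w' ! p = w ! p \<or> w' ! p \<in> {a, Suc a}" using assms(1) p unfolding differ_within_def by blast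
    ultimately show "l \<in> B" using that p by auto
  qed
qed

lemma walk_height_length: "walk_height a w (length w) = int (count_list w a) - int (count_list w (Suc a))"
  using walk_height_diff[of 0 "length w" a w]
  by (simp add: count_list_card)

section \<open>Weak majorisation of the lower rows\<close>

lemma not_yamanouchi_raise:
  assumes "\<not> yamanouchi A w"
  obtains a p where "a \<in> A" "Suc a \<in> A" "p < length w" "w ! p = Suc a" "raises a (w[p := a]) p"
proof -
  from assms obtain a q where aq: "a \<in> A" "Suc a \<in> A" "q \<le> length w" "walk_height a w (length w) < walk_height a w q"
    unfolding yamanouchi_def by force
  then have "walk_height a w (length w) < peak a (length w) w" using peak_ge[of q "length w" a w] by simp
  then obtain p where p: "record_step a (length w) w (Suc a) p" using ex_down_record by blast
  then have "p < length w" "w ! p = Suc a" by (auto simp: record_step_def)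
  moreover have "raises a (w[p := a]) p"
    by (rule raises_of_record_step[OF record_step_flip_up[OF p]]) auto
  ultimately show thesis using that aq by blast
qed

text \<open>Well-founded because changing \<open>Suc a\<close> into \<open>a\<close> decreases the
  sum of the letters.\<close>

lemma yamanouchi_induct [case_names yamanouchi raise]:
  assumes "\<And>w. yamanouchi A w \<Longrightarrow> P w"
    and "\<And>w a p. a \<in> A \<Longrightarrow> Suc a \<in> A \<Longrightarrow> p < length w \<Longrightarrow> w ! p = Suc a \<Longrightarrow>
           raises a (w[p := a]) p \<Longrightarrow> P (w[p := a]) \<Longrightarrow> P w"
  shows "P w"
proof (induction "sum_list w" arbitrary: w rule: less_induct)
  case less
  show ?case
  proof (cases "yamanouchi A w")
    case True
    then show ?thesis by (rule assms(1))
  next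
    case False
    then obtain a p where ap: "a \<in> A" "Suc a \<in> A" "p < length w" "w ! p = Suc a" "raises a (w[p := a]) p"
      by (rule not_yamanouchi_raise)
    have "w ! p \<le> sum_list w" using ap(3) by (simp add: elem_le_sum_list)
    then have "sum_list (w[p := a]) < sum_list w" using ap(3,4) by (simp add: sum_list_update)
    from assms(2)[OF ap less[OF this]] show ?thesis .
  qed
qed

text \<open>An alphabet \<open>{k..<hi}\<close> containing both \<open>a\<close> and
  \<open>Suc a\<close> sees a genuine crystal operator and keeps its Greene numbers. One that
  contains at most \<open>Suc a\<close> can only lose a letter, hence the inequality for
  subalphabets.\<close>

lemma yamanouchi_representative:
  obtains u where "yamanouchi {lo..<hi} u" "length u = length w" 
    "\<And>j. greene_on u {lo..<hi} j = greene_on w {lo..<hi} j"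
    "\<And>k j. lo \<le> k \<Longrightarrow> greene_on u {k..<hi} j \<le> greene_on w {k..<hi} j"
    "active u {lo..<hi} = active w {lo..<hi}"
proof -
  have "\<exists>u. yamanouchi {lo..<hi} u \<and> length u = length w \<and>
    (\<forall>j. greene_on u {lo..<hi} j = greene_on w {lo..<hi} j) \<and>
    (\<forall>k j. lo \<le> k \<longrightarrow> greene_on u {k..<hi} j \<le> greene_on w {k..<hi} j) \<and>
    active u {lo..<hi} = active w {lo..<hi}"
  proof (induction w rule: yamanouchi_induct[where A = "{lo..<hi}"])
    case (raise w a p)
    let ?v = "w[p := a]"
    have w: "?v[p := Suc a] = w" using raise(4) by (metis list_update_id list_update_overwrite)
    have 1: "greene_on ?v {k..<hi} j = greene_on w {k..<hi} j" if "lo \<le> k" "k \<le> a" for k j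
      using greene_on_raise[OF raise(5), of "{k..<hi}" j] raise(1,2) that unfolding w by simp
    have 2: "greene_on ?v {k..<hi} j \<le> greene_on w {k..<hi} j" if "lo \<le> k" for k j
    proof (cases "k \<le> a")
      \<comment> \<open>For \<open>k = Suc a\<close> position \<open>p\<close> drops out of the
        subword; for larger \<open>k\<close> nothing changes.\<close>
      case False
      then have same: "?v ! x = w ! x" if "x \<in> active ?v {k..<hi}" for x
        using that raise(3) by (cases "x = p") (auto simp: active_def)
      show ?thesis
      proof (rule greene_on_mono_positions)
        show "active ?v {k..<hi} \<subseteq> active w {k..<hi}"
          using same by (auto simp: active_def) 
      qed (use same in simp)
    qed (simp add: 1 that)
    have 3: "active ?v {lo..<hi} = active w {lo..<hi}"
      using active_update[of a "{lo..<hi}" ?v p] raise(1-3) unfolding w by simp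
    from raise(6) obtain u where "yamanouchi {lo..<hi} u" "length u = length ?v"
      "\<forall>j. greene_on u {lo..<hi} j = greene_on ?v {lo..<hi} j"
      "\<forall>k j. lo \<le> k \<longrightarrow> greene_on u {k..<hi} j \<le> greene_on ?v {k..<hi} j"
      "active u {lo..<hi} = active ?v {lo..<hi}" by blast
    moreover have "lo \<le> a" using raise(1) by simp
    ultimately have "yamanouchi {lo..<hi} u" "length u = length w"
      "\<forall>j. greene_on u {lo..<hi} j = greene_on w {lo..<hi} j"
      "\<forall>k j. lo \<le> k \<longrightarrow> greene_on u {k..<hi} j \<le> greene_on w {k..<hi} j"
      "active u {lo..<hi} = active w {lo..<hi}"
      using 1[of lo] 3 by (simp_all add: order_trans[OF _ 2])
    then show ?case by blast
  qed blast
  then show thesis using that by blast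
qed

text \<open>Rows are counted from 0 here, whereas \<open>shRSK\<close> counts from 1. Real values
  avoid truncated subtraction before monotonicity of the Greene numbers is known.\<close>

definition row_length :: "nat list \<Rightarrow> nat set \<Rightarrow> nat \<Rightarrow> real" where
  "row_length w A j = real (greene_on w A (Suc j)) - real (greene_on w A j)"

lemma sum_row_length: "(\<Sum>j<J. row_length w A j) = real (greene_on w A J) - real (greene_on w A 0)"
  unfolding row_length_def by (rule sum_lessThan_telescope)

lemma greene_on_0 [simp]: "greene_on w A 0 = 0"
  using greene_on_obtain[of w A 0] by (metis family_size_def lessThan_0 sum.empty)

lemma row_length_yamanouchi:
  assumes "yamanouchi {lo..<hi} u" "lo + j < hi"
  shows "row_length u {lo..<hi} j = real (count_list u (lo + j))"
proof -
  have "card {p. p < length u \<and> lo \<le> u ! p \<and> u ! p < lo + Suc j} =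
        card ({p. p < length u \<and> lo \<le> u ! p \<and> u ! p < lo + j} \<union> {p. p < length u \<and> u ! p = lo + j})"
    by (rule arg_cong[where f = card]) auto
  also have "\<dots> = card {p. p < length u \<and> lo \<le> u ! p \<and> u ! p < lo + j} + card {p. p < length u \<and> u ! p = lo + j}"
    by (rule card_Un_disjoint) auto
  finally show ?thesis
    using greene_on_yamanouchi[OF assms(1), of j] greene_on_yamanouchi[OF assms(1), of "Suc j"] assms(2)
    unfolding row_length_def by (simp add: count_list_card)
qed

text \<open>That the differences of Greene numbers form a partition is read off from the letter
  counts of the Yamanouchi representative, which decrease along the alphabet.\<close>

lemma row_length_nonneg_antimono:
  assumes "lo + j < hi"
  shows "0 \<le> row_length w {lo..<hi} j" "i \<le> j \<Longrightarrow> row_length w {lo..<hi} j \<le> row_length w {lo..<hi} i"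
proof -
  obtain u where u: "yamanouchi {lo..<hi} u" "\<And>j. greene_on u {lo..<hi} j = greene_on w {lo..<hi} j"
    using yamanouchi_representative[of lo hi w] by metis
  have r: "row_length w {lo..<hi} i = real (count_list u (lo + i))" if "lo + i < hi" for i
    using row_length_yamanouchi[OF u(1) that] u(2) by (simp add: row_length_def)
  show "0 \<le> row_length w {lo..<hi} j" using r[OF assms] by simp
  assume "i \<le> j"
  then show "row_length w {lo..<hi} j \<le> row_length w {lo..<hi} i"
    using r[OF assms] r[of i] assms yamanouchi_suffix[OF u(1), of 0 "lo + i" "lo + j"]
    by (simp add: count_list_card)
qed

lemma sum_row_eq_card_active:
  "(\<Sum>j<hi - lo. row_length w {lo..<hi} j) = real (card (active w {lo..<hi}))"
proof -
  obtain u where u: "yamanouchi {lo..<hi} u" "\<And>j. greene_on u {lo..<hi} j = greene_on w {lo..<hi} j"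
    "active u {lo..<hi} = active w {lo..<hi}"
    using yamanouchi_representative[of lo hi w] by metis
  show ?thesis
  proof (cases "lo \<le> hi")
    case True
    then have "greene_on u {lo..<hi} (hi - lo) = card (active u {lo..<hi})"
      using greene_on_yamanouchi[OF u(1), of "hi - lo"] by (simp add: active_def)
    then show ?thesis using u unfolding sum_row_length by simp
  qed (simp add: active_def)
qed

lemma abel_sum_nonneg:
  fixes a c :: "nat \<Rightarrow> real"
  assumes "\<And>j. Suc j < D \<Longrightarrow> a (Suc j) \<le> a j" "\<And>j. j < D \<Longrightarrow> 0 \<le> a j"
    and "\<And>J. J \<le> D \<Longrightarrow> 0 \<le> (\<Sum>j<J. c j)"
  shows "0 \<le> (\<Sum>j<D. a j * c j)"
proof (cases D)
  case (Suc m)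
  have "a n * (\<Sum>j<Suc n. c j) \<le> (\<Sum>j<Suc n. a j * c j)" if "n < D" for n
    using that
  proof (induction n)
    case (Suc n)
    have "a (Suc n) * (\<Sum>j<Suc n. c j) \<le> a n * (\<Sum>j<Suc n. c j)"
      using assms(1)[of n] assms(3)[of "Suc n"] Suc.prems by (intro mult_right_mono) auto
    with Suc show ?case by (simp add: distrib_left)
  qed simp
  from this[of m] have "a m * (\<Sum>j<D. c j) \<le> (\<Sum>j<D. a j * c j)" using Suc by simp
  moreover have "0 \<le> a m * (\<Sum>j<D. c j)" using assms(2)[of m] assms(3)[of D] Suc by simp
  ultimately show ?thesis by linarith
qed simp

text \<open>Write b^2 - a^2 = (b - a)^2 + 2a(b - a); the second part has nonnegative sum by Abel
  summation, since \<open>a\<close> is decreasing and nonnegative.\<close>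

lemma weak_majorization_sum_squares:
  fixes a b :: "nat \<Rightarrow> real"
  assumes "\<And>j. Suc j < D \<Longrightarrow> a (Suc j) \<le> a j" "\<And>j. j < D \<Longrightarrow> 0 \<le> a j"
    and "\<And>J. J \<le> D \<Longrightarrow> (\<Sum>j<J. a j) \<le> (\<Sum>j<J. b j)"
  shows "(\<Sum>j<D. (a j)\<^sup>2) \<le> (\<Sum>j<D. (b j)\<^sup>2)"
proof -
  have "0 \<le> (\<Sum>j<D. a j * (b j - a j))"
    by (rule abel_sum_nonneg) (use assms in \<open>auto simp: sum_subtractf\<close>)
  moreover have "0 \<le> (\<Sum>j<D. (b j - a j)\<^sup>2)" by (rule sum_nonneg) simp
  moreover have "(\<Sum>j<D. (b j)\<^sup>2) - (\<Sum>j<D. (a j)\<^sup>2) = (\<Sum>j<D. (b j - a j)\<^sup>2) + 2 * (\<Sum>j<D. a j * (b j - a j))"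
    unfolding sum_distrib_left sum_subtractf[symmetric] sum.distrib[symmetric]
    by (rule sum.cong) (auto simp: power2_eq_square algebra_simps)
  ultimately show ?thesis by linarith
qed

text \<open>A Yamanouchi word \<open>u\<close> stays Yamanouchi on the letters from \<open>k\<close>
  on. Its multiplicities of k, ..., d are therefore at once the rows k, ..., d of its full shape,
  which is that of \<open>w\<close>, and all the rows of the shape of its subword, whose Greene
  numbers are at most those of the subword of \<open>w\<close>.\<close>

lemma lower_rows_weakly_majorized:
  assumes w: "set w \<subseteq> {1..d}" and k: "k \<in> {1..d}"
  shows "(\<Sum>i=k..d. (real (shRSK w i))\<^sup>2) \<le> (\<Sum>j<Suc d - k. (row_length w {k..<Suc d} j)\<^sup>2)"
proof -
  let ?A = "{1..<Suc d}"
  obtain u where u: "yamanouchi ?A u" "\<And>j. greene_on u ?A j = greene_on w ?A j"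
    "\<And>k j. 1 \<le> k \<Longrightarrow> greene_on u {k..<Suc d} j \<le> greene_on w {k..<Suc d} j"
    using yamanouchi_representative[of 1 "Suc d" w] by metis
  have yk: "yamanouchi {k..<Suc d} u" using u(1) k unfolding yamanouchi_def by auto
  have gr: "greene w j = greene_on w ?A j" for j
    by (rule greene_eq_greene_on) (use w in auto)
  have sh: "real (shRSK w (k + j)) = real (count_list u (k + j))" if "j < Suc d - k" for j
  proof -
    have le: "1 + (k + j - 1) < Suc d" "1 + (k + j - 1) = k + j" using k that by auto
    have "real (count_list u (k + j)) = row_length u ?A (k + j - 1)"
      using row_length_yamanouchi[OF u(1), of "k + j - 1"] le by simp
    also have "\<dots> = real (greene w (k + j)) - real (greene w (k + j - 1))"
      using le(2) by (simp only: row_length_def u(2) gr plus_1_eq_Suc)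
    finally have "real (count_list u (k + j)) = real (greene w (k + j)) - real (greene w (k + j - 1))" .
    then show ?thesis by (simp add: shRSK_def of_nat_diff)
  qed
  have "(\<Sum>i=k..d. (real (shRSK w i))\<^sup>2) = (\<Sum>j<Suc d - k. (real (shRSK w (k + j)))\<^sup>2)"
    by (rule sum.reindex_bij_witness[of _ "\<lambda>j. k + j" "\<lambda>i. i - k"]) (use k in auto)
  also have "\<dots> = (\<Sum>j<Suc d - k. (row_length u {k..<Suc d} j)\<^sup>2)"
    by (rule sum.cong) (use sh row_length_yamanouchi[OF yk] in auto)
  also have "\<dots> \<le> (\<Sum>j<Suc d - k. (row_length w {k..<Suc d} j)\<^sup>2)"
  proof (rule weak_majorization_sum_squares)
    show "row_length u {k..<Suc d} (Suc j) \<le> row_length u {k..<Suc d} j" if "Suc j < Suc d - k" for j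
      by (rule row_length_nonneg_antimono(2)) (use that in auto)
    show "0 \<le> row_length u {k..<Suc d} j" if "j < Suc d - k" for j
      by (rule row_length_nonneg_antimono(1)) (use that in auto)
    show "(\<Sum>j<J. row_length u {k..<Suc d} j) \<le> (\<Sum>j<J. row_length w {k..<Suc d} j)" for J
      using u(3)[of k J] k unfolding sum_row_length by simp
  qed
  finally show ?thesis .
qed

section \<open>The sign-reversing involution\<close>

definition words :: "nat \<Rightarrow> nat \<Rightarrow> nat list set" where
  "words D n = {w. set w \<subseteq> {..D} \<and> length w = n}"

lemma finite_words [simp]: "finite (words D n)"
  unfolding words_def by (rule finite_lists_length_eq) simp

text \<open>Letters below \<open>D\<close> are active, with their multiplicities shifted by the staircase;
  the letter \<open>D\<close> is a blank.\<close>

definition shifted_weight :: "nat \<Rightarrow> nat list \<Rightarrow> nat \<Rightarrow> nat" where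
  "shifted_weight D w i = count_list w i + (D - 1 - i)"

definition violations :: "nat \<Rightarrow> nat list \<Rightarrow> nat set" where
  "violations D w = {q. q \<le> length w \<and> (\<exists>a. Suc a < D \<and> walk_height a w (length w) < walk_height a w q)}"

lemma violations_empty_iff: "violations D w = {} \<longleftrightarrow> yamanouchi {0..<D} w"
proof
  assume "violations D w = {}"
  then show "yamanouchi {0..<D} w"
    unfolding violations_def yamanouchi_def
    by (metis (mono_tags, lifting) atLeastLessThan_iff empty_Collect_eq leI)
next
  assume y: "yamanouchi {0..<D} w"
  have "walk_height a w q \<le> walk_height a w (length w)" if "Suc a < D" "q \<le> length w" for a q
    using y that by (simp add: yamanouchi_def)
  then show "violations D w = {}" by (fastforce simp: violations_def)
qed

lemma finite_violations [simp]: "finite (violations D w)"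
  by (rule finite_subset[of _ "{..length w}"]) (auto simp: violations_def)

text \<open>The maximal violation starts the shortest bad suffix, and its first letter reveals which
  pair of letters is violated. Since nothing from that position on changes, a second application
  finds the same position and the same pair.\<close>

definition flip_word :: "nat \<Rightarrow> nat list \<Rightarrow> nat list" where
  "flip_word D w = (let s = Max (violations D w) in reflect (w ! s - 1) s w)"

text \<open>All shorter suffixes are good and one letter moves the walk by at most one, so the bad
  suffix starts with \<open>Suc a\<close> and has an excess of exactly one. The last conclusion is
  the premise of \<open>stable\<close>.\<close>

lemma Max_violation:
  assumes "violations D w \<noteq> {}" "s = Max (violations D w)"
  obtains a where "Suc a < D" "s < length w" "w ! s = Suc a"
    "walk_height a w (length w) = walk_height a w s - 1"
    "\<And>r. s \<le> r \<Longrightarrow> r \<le> length w \<Longrightarrow> walk_height a w r \<le> walk_height a w s"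
proof -
  have "s \<in> violations D w" using assms by simp
  then obtain a where a: "s \<le> length w" "Suc a < D" "walk_height a w (length w) < walk_height a w s"
    by (auto simp: violations_def)
  have later: "walk_height a w r \<le> walk_height a w (length w)" if "s < r" "r \<le> length w" for r
  proof (rule ccontr)
    assume "\<not> ?thesis"
    then have "r \<in> violations D w" using that a(2) unfolding violations_def by auto
    then have "r \<le> s" using Max_ge[OF finite_violations] assms(2) by simp
    then show False using that by simp
  qed
  have s: "s < length w" using a by (cases "s = length w") auto
  have "walk_height a w (Suc s) \<le> walk_height a w (length w)" using later[of "Suc s"] s by simp
  with a(3) have "w ! s = Suc a" "walk_height a w (length w) = walk_height a w s - 1"
    by (auto simp: walk_height_Suc split: if_splits)
  moreover have "walk_height a w r \<le> walk_height a w s" if "s \<le> r" "r \<le> length w" for r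
    using later[of r] that a(3) by (cases "r = s") auto
  ultimately show thesis using that[of a] a s by blast
qed

text \<open>Reflection negates the surplus of \<open>a\<close> over \<open>Suc a\<close> in the
  prefix, while the suffix keeps surplus -1. The new multiplicities are the old ones exchanged, with
  one less \<open>a\<close> and one more \<open>Suc a\<close>; consecutive staircase entries differ
  by one and absorb this.\<close>

lemma flip_word_props:
  assumes w: "w \<in> words D n" "\<not> yamanouchi {0..<D} w"
  shows "flip_word D w \<in> words D n" "\<not> yamanouchi {0..<D} (flip_word D w)"
    "flip_word D (flip_word D w) = w"
    "greene_on (flip_word D w) {0..<D} k = greene_on w {0..<D} k"
    "\<exists>a. Suc a < D \<and> (\<forall>i. shifted_weight D (flip_word D w) i = shifted_weight D w (Transposition.transpose a (Suc a) i))"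
proof -
  have ne: "violations D w \<noteq> {}" using w violations_empty_iff by blast
  define s where "s = Max (violations D w)"
  obtain a where a: "Suc a < D" "s < length w" "w ! s = Suc a"
    "walk_height a w (length w) = walk_height a w s - 1"
    "\<And>r. s \<le> r \<Longrightarrow> r \<le> length w \<Longrightarrow> walk_height a w r \<le> walk_height a w s"
    using Max_violation[OF ne s_def] by metis
  let ?v = "reflect a s w"
  have v: "flip_word D w = ?v" using a by (simp add: flip_word_def s_def[symmetric])
  have sl: "s \<le> length w" using a by simp
  note R = reflect_props[OF sl, of a]
  have dw: "differ_within a s w ?v" using R(2) by (simp add: stable_def)
  then have len: "length ?v = length w" by (simp add: differ_within_def)
  have tail: "walk_height b ?v (length w) - walk_height b ?v r = walk_height b w (length w) - walk_height b w r"
    if "s \<le> r" "r \<le> length w" for b r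
    using differ_within_tail[OF dw that] by simp
  have viol: "r \<in> violations D ?v \<longleftrightarrow> r \<in> violations D w" if "s \<le> r" for r
  proof (cases "r \<le> length w")
    case True
    have "walk_height b ?v (length w) < walk_height b ?v r \<longleftrightarrow> walk_height b w (length w) < walk_height b w r" for b
      using tail[OF that True, of b] by linarith
    then show ?thesis by (simp add: violations_def len)
  qed (simp add: violations_def len)
  have sv: "s \<in> violations D ?v" using viol[of s] Max_in[OF finite_violations ne] by (simp add: s_def)
  moreover have "r \<le> s" if "r \<in> violations D ?v" for r
    using viol[of r] that Max_ge[OF finite_violations, of r D w] by (cases "s \<le> r") (auto simp: s_def)
  ultimately have smax: "Max (violations D ?v) = s" by (intro Max_eqI) auto
  have vs: "?v ! s = Suc a" using dw a by (auto simp: differ_within_def)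
  show "flip_word D (flip_word D w) = w" unfolding v by (simp add: flip_word_def smax vs R(3))
  show "\<not> yamanouchi {0..<D} (flip_word D w)" using sv v violations_empty_iff[of D "flip_word D w"] by auto
  have "set ?v \<subseteq> {..D}"
    by (rule differ_within_counts(3)[OF dw sl]) (use w a in \<open>auto simp: words_def\<close>)
  then show "flip_word D w \<in> words D n" using w len v by (simp add: words_def)
  show "greene_on (flip_word D w) {0..<D} k = greene_on w {0..<D} k"
    using R(2) a unfolding v stable_def by simp
  \<comment> \<open>If the prefix height is h, the total changes from h - 1 to -h - 1.\<close>
  have h: "walk_height a ?v (length ?v) = - walk_height a w (length w) - 2"
    using tail[of s a] R(1) a(4) sl len by simp
  have cs: "count_list ?v a + count_list ?v (Suc a) = count_list w a + count_list w (Suc a)"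
    by (rule differ_within_counts(2)[OF dw sl])
  have "int (count_list ?v a) + 1 = int (count_list w (Suc a))" "int (count_list ?v (Suc a)) = int (count_list w a) + 1"
    using h cs unfolding walk_height_length by linarith+
  then have ca: "Suc (count_list ?v a) = count_list w (Suc a)" "count_list ?v (Suc a) = Suc (count_list w a)" by linarith+
  have "shifted_weight D ?v i = shifted_weight D w (Transposition.transpose a (Suc a) i)" for i
  proof -
    consider "i = a" | "i = Suc a" | "i \<noteq> a" "i \<noteq> Suc a" by blast
    then show ?thesis
    proof cases
      case 1 then show ?thesis using ca a(1) by (simp add: shifted_weight_def)
    next
      case 2 then show ?thesis using ca a(1) by (simp add: shifted_weight_def)
    next
      case 3 then show ?thesis using differ_within_counts(1)[OF dw sl] by (simp add: shifted_weight_def)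
    qed
  qed
  then show "\<exists>a. Suc a < D \<and> (\<forall>i. shifted_weight D (flip_word D w) i = shifted_weight D w (Transposition.transpose a (Suc a) i))"
    using a(1) v by auto
qed

lemma sum_words_yamanouchi:
  fixes F :: "nat list \<Rightarrow> real"
  assumes "\<And>w w' a. w \<in> words D n \<Longrightarrow> w' \<in> words D n \<Longrightarrow> Suc a < D \<Longrightarrow>
      (\<And>k. greene_on w' {0..<D} k = greene_on w {0..<D} k) \<Longrightarrow>
      (\<And>i. shifted_weight D w' i = shifted_weight D w (Transposition.transpose a (Suc a) i)) \<Longrightarrow> F w' = - F w"
  shows "(\<Sum>w\<in>words D n. F w) = (\<Sum>w\<in>{w\<in>words D n. yamanouchi {0..<D} w}. F w)"
proof -
  let ?B = "{w\<in>words D n. \<not> yamanouchi {0..<D} w}"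
  have "(\<Sum>w\<in>?B. F w) = (\<Sum>w\<in>?B. - F w)"
  proof (rule sum.reindex_bij_witness[of _ "flip_word D" "flip_word D"])
    fix w assume w: "w \<in> ?B"
    then have W: "w \<in> words D n" "\<not> yamanouchi {0..<D} w" by auto
    note P = flip_word_props[OF W]
    show "flip_word D (flip_word D w) = w" "flip_word D w \<in> ?B"
      "flip_word D (flip_word D w) = w" "flip_word D w \<in> ?B" using P by auto
    show "- F (flip_word D w) = F w" using P(5) assms[OF W(1) P(1) _ P(4)] by auto
  qed
  then have "(\<Sum>w\<in>?B. F w) = 0" by (simp add: sum_negf)
  moreover have "(\<Sum>w\<in>words D n. F w) = (\<Sum>w\<in>{w\<in>words D n. yamanouchi {0..<D} w}. F w) + (\<Sum>w\<in>?B. F w)"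
  proof -
    have "words D n = {w\<in>words D n. yamanouchi {0..<D} w} \<union> ?B" by auto
    then have "sum F (words D n) = sum F ({w\<in>words D n. yamanouchi {0..<D} w} \<union> ?B)" by simp
    also have "\<dots> = (\<Sum>w\<in>{w\<in>words D n. yamanouchi {0..<D} w}. F w) + (\<Sum>w\<in>?B. F w)"
      by (rule sum.union_disjoint) auto
    finally show ?thesis .
  qed
  ultimately show ?thesis by simp
qed

section \<open>Moments and alternants\<close>

text \<open>A kernel vector of the matrix would be the coefficient vector of a nonzero polynomial of
  degree below \<open>D\<close> with \<open>D\<close> distinct roots.\<close>

lemma vandermonde_nonzero:
  fixes x :: "nat \<Rightarrow> real"
  assumes "inj_on x {0..<D}"
  shows "(\<Sum>\<sigma> | \<sigma> permutes {0..<D}. of_int (sign \<sigma>) * (\<Prod>i\<in>{0..<D}. x (\<sigma> i) ^ (D - 1 - i))) \<noteq> 0"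
proof
  assume 0: "(\<Sum>\<sigma> | \<sigma> permutes {0..<D}. of_int (sign \<sigma>) * (\<Prod>i\<in>{0..<D}. x (\<sigma> i) ^ (D - 1 - i))) = 0"
  define V where "V = Matrix.mat D D (\<lambda>(j, i). x j ^ (D - 1 - i))"
  have V: "V \<in> carrier_mat D D" by (simp add: V_def)
  have "Determinant.det (transpose_mat V) = (\<Sum>\<sigma> | \<sigma> permutes {0..<D}. of_int (sign \<sigma>) * (\<Prod>i\<in>{0..<D}. x (\<sigma> i) ^ (D - 1 - i)))"
  proof -
    have "(\<Prod>i\<in>{0..<D}. transpose_mat V $$ (i, \<sigma> i)) = (\<Prod>i\<in>{0..<D}. x (\<sigma> i) ^ (D - 1 - i))"
      if "\<sigma> permutes {0..<D}" for \<sigma>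
    proof (rule prod.cong)
      fix i assume "i \<in> {0..<D}"
      moreover from this have "\<sigma> i < D" using permutes_in_image[OF that, of i] by simp
      ultimately show "transpose_mat V $$ (i, \<sigma> i) = x (\<sigma> i) ^ (D - 1 - i)" by (simp add: V_def)
    qed simp
    then show ?thesis using det_def'[of "transpose_mat V" D] V by simp
  qed
  then have "Determinant.det V = 0" using 0 det_transpose[OF V] by simp
  then obtain v where v: "v \<in> carrier_vec D" "v \<noteq> 0\<^sub>v D" "V *\<^sub>v v = 0\<^sub>v D"
    using det_0_iff_vec_prod_zero[OF V] by blast
  define p where "p = (\<Sum>i<D. monom (vec_index v i) (D - 1 - i))"
  have coeff: "poly.coeff p (D - 1 - i) = vec_index v i" if "i < D" for i
  proof -
    have "poly.coeff p (D - 1 - i) = (\<Sum>i'<D. if i' = i then vec_index v i' else 0)"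
      unfolding p_def coeff_sum coeff_monom by (rule sum.cong) (use that in auto)
    then show ?thesis using that by simp
  qed
  have "poly p (x j) = 0" if "j < D" for j
  proof -
    have "poly p (x j) = (\<Sum>i<D. x j ^ (D - 1 - i) * vec_index v i)"
      by (simp add: p_def poly_sum poly_monom mult.commute)
    also have "\<dots> = vec_index (V *\<^sub>v v) j"
      using that v(1) by (simp add: V_def scalar_prod_def lessThan_atLeast0)
    finally show ?thesis using that v(3) by simp
  qed
  then have sub: "x ` {0..<D} \<subseteq> {z. poly p z = 0}" by auto
  have "p = 0"
  proof (rule ccontr)
    assume "p \<noteq> 0"
    then have "card (x ` {0..<D}) \<le> degree p"
      using card_mono[OF poly_roots_finite sub] card_poly_roots_bound[of p] by linarith
    then have "D \<le> degree p" using assms by (simp add: card_image)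
    moreover have "degree p \<le> D - 1"
      unfolding p_def by (rule degree_sum_le) (auto intro: order_trans[OF degree_monom_le])
    ultimately have "D = 0" by linarith
    then show False using \<open>p \<noteq> 0\<close> by (simp add: p_def)
  qed
  then have "v = 0\<^sub>v D" using coeff v(1) by auto
  then show False using v(2) by simp
qed

section \<open>Multinomial moments of letter counts\<close>

lemma sum_words_Suc:
  "(\<Sum>w\<in>words D (Suc n). F w) = (\<Sum>l\<le>D. \<Sum>w\<in>words D n. F (l # w))"
proof -
  have W: "words D (Suc n) = (\<lambda>(l, w). l # w) ` ({..D} \<times> words D n)"
    by (auto simp: words_def length_Suc_conv image_iff)
  have "(\<Sum>w\<in>words D (Suc n). F w) = (\<Sum>(l, w)\<in>{..D} \<times> words D n. F (l # w))"
    unfolding W by (subst sum.reindex) (auto simp: inj_on_def case_prod_unfold)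
  then show ?thesis by (simp add: sum.cartesian_product)
qed

text \<open>Weights are plain reals rather than a \<open>pmf\<close>: the identities are later used
  at perturbed weights, where the blank may become negative.\<close>

definition word_weight :: "(nat \<Rightarrow> real) \<Rightarrow> nat list \<Rightarrow> real" where
  "word_weight y w = prod_list (map y w)"

lemma word_weight_counts:
  "w \<in> words D n \<Longrightarrow> word_weight y w = (\<Prod>l\<le>D. y l ^ count_list w l)"
proof (induction w arbitrary: n)
  case (Cons l w)
  have l: "l \<le> D" "w \<in> words D (n - 1)" using Cons.prems by (auto simp: words_def)
  have "(\<Prod>i\<le>D. y i ^ count_list (l # w) i) = (\<Prod>i\<le>D. y i ^ count_list w i) * (\<Prod>i\<le>D. if i = l then y i else 1)"
    unfolding prod.distrib[symmetric] by (rule prod.cong) auto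
  also have "(\<Prod>i\<le>D. if i = l then y i else 1) = y l" using l by (simp add: prod.delta)
  finally show ?case using Cons.IH[OF l(2)] by (simp add: word_weight_def)
qed (simp add: word_weight_def)

lemma
  assumes y: "(\<Sum>l\<le>D. y l) = (1::real)"
  shows sum_word_weight: "(\<Sum>w\<in>words D n. word_weight y w) = 1"
    and sum_word_weight_count: "i \<le> D \<Longrightarrow> (\<Sum>w\<in>words D n. word_weight y w * real (count_list w i)) = real n * y i"
    and sum_word_weight_count_sq: "i \<le> D \<Longrightarrow> (\<Sum>w\<in>words D n. word_weight y w * (real (count_list w i))\<^sup>2)
           = real n * (real n - 1) * (y i)\<^sup>2 + real n * y i"
proof -
  have W0: "words D 0 = {[]}" by (auto simp: words_def)
  have pull: "(\<Sum>l\<le>D. y l * c) = c" for c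
    using y by (simp add: sum_distrib_right[symmetric])
  have delta: "(\<Sum>l\<le>D. y l * (if l = i then c else 0)) = y i * c" if "i \<le> D" for i c
    using that by (simp add: if_distrib cong: if_cong)
  show 0: "(\<Sum>w\<in>words D n. word_weight y w) = 1" for n
  proof (induction n)
    case (Suc n)
    then show ?case using y by (simp add: sum_words_Suc word_weight_def sum_distrib_left[symmetric])
  qed (simp add: W0 word_weight_def)
  show 1: "(\<Sum>w\<in>words D n. word_weight y w * real (count_list w i)) = real n * y i" if i: "i \<le> D" for n i
  proof (induction n)
    case (Suc n)
    have "(\<Sum>w\<in>words D (Suc n). word_weight y w * real (count_list w i)) =
      (\<Sum>l\<le>D. \<Sum>w\<in>words D n. y l * (word_weight y w * real (count_list w i)) + y l * (if l = i then word_weight y w else 0))"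
      unfolding sum_words_Suc by (intro sum.cong refl) (auto simp: word_weight_def algebra_simps)
    also have "\<dots> = (\<Sum>l\<le>D. y l * (real n * y i)) + (\<Sum>l\<le>D. y l * (if l = i then 1 else 0))"
      unfolding sum.distrib sum_distrib_left[symmetric] Suc
      by (intro arg_cong2[where f = "(+)"] refl sum.cong) (auto simp: 0)
    also have "\<dots> = real (Suc n) * y i" unfolding pull delta[OF i] by (simp add: algebra_simps)
    finally show ?case .
  qed (simp add: W0)
  show "(\<Sum>w\<in>words D n. word_weight y w * (real (count_list w i))\<^sup>2)
           = real n * (real n - 1) * (y i)\<^sup>2 + real n * y i" if i: "i \<le> D"
  proof (induction n)
    case (Suc n)
    have "(\<Sum>w\<in>words D (Suc n). word_weight y w * (real (count_list w i))\<^sup>2) =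
      (\<Sum>l\<le>D. \<Sum>w\<in>words D n. y l * (word_weight y w * (real (count_list w i))\<^sup>2) +
          y l * (if l = i then 2 * (word_weight y w * real (count_list w i)) + word_weight y w else 0))"
      unfolding sum_words_Suc by (intro sum.cong refl) (auto simp: word_weight_def algebra_simps power2_eq_square)
    also have "\<dots> = (\<Sum>l\<le>D. y l * (real n * (real n - 1) * (y i)\<^sup>2 + real n * y i)) +
        (\<Sum>l\<le>D. y l * (if l = i then 2 * (real n * y i) + 1 else 0))"
      unfolding sum.distrib sum_distrib_left[symmetric] Suc
      by (intro arg_cong2[where f = "(+)"] refl sum.cong)
         (auto simp: 0 1[OF i] sum.distrib sum_distrib_left[symmetric])
    also have "\<dots> = real (Suc n) * (real (Suc n) - 1) * (y i)\<^sup>2 + real (Suc n) * y i"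
      unfolding pull delta[OF i] by (simp add: algebra_simps power2_eq_square)
    finally show ?case .
  qed (simp add: W0)
qed

definition alternant :: "nat \<Rightarrow> (nat \<Rightarrow> real) \<Rightarrow> (nat \<Rightarrow> nat) \<Rightarrow> real" where
  "alternant D x v = (\<Sum>\<sigma> | \<sigma> permutes {0..<D}. of_int (sign \<sigma>) * (\<Prod>i\<in>{0..<D}. x (\<sigma> i) ^ v i))"

lemma alternant_transpose:
  assumes "a < D" "b < D" "a \<noteq> b"
  shows "alternant D x (\<lambda>i. v (Transposition.transpose a b i)) = - alternant D x v"
proof -
  let ?t = "Transposition.transpose a b"
  have t: "?t permutes {0..<D}" by (rule permutes_swap_id) (use assms in auto)
  have "alternant D x (\<lambda>i. v (?t i)) =
      (\<Sum>\<sigma> | \<sigma> permutes {0..<D}. of_int (sign (\<sigma> \<circ> ?t)) * (\<Prod>i\<in>{0..<D}. x ((\<sigma> \<circ> ?t) i) ^ v (?t i)))"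
    unfolding alternant_def by (rule sum_permutations_compose_right[OF t])
  also have "\<dots> = (\<Sum>\<sigma> | \<sigma> permutes {0..<D}. - (of_int (sign \<sigma>) * (\<Prod>i\<in>{0..<D}. x (\<sigma> i) ^ v i)))"
  proof (rule sum.cong)
    fix \<sigma> assume "\<sigma> \<in> {\<sigma>. \<sigma> permutes {0..<D}}"
    then have "permutation \<sigma>" by (auto intro: permutes_imp_permutation)
    then have "sign (\<sigma> \<circ> ?t) = - sign \<sigma>"
      using sign_compose[of \<sigma> ?t] assms(3) by (simp add: sign_swap_id permutation_swap_id)
    moreover have "(\<Prod>i\<in>{0..<D}. x ((\<sigma> \<circ> ?t) i) ^ v (?t i)) = (\<Prod>i\<in>{0..<D}. x (\<sigma> i) ^ v i)"
      using prod.permute[OF t, of "\<lambda>i. x (\<sigma> i) ^ v i"] by (simp add: o_def)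
    ultimately show "of_int (sign (\<sigma> \<circ> ?t)) * (\<Prod>i\<in>{0..<D}. x ((\<sigma> \<circ> ?t) i) ^ v (?t i)) =
        - (of_int (sign \<sigma>) * (\<Prod>i\<in>{0..<D}. x (\<sigma> i) ^ v i))" by simp
  qed simp
  finally show ?thesis by (simp add: alternant_def sum_negf)
qed

text \<open>Evaluates the cross term between letter counts and staircase. The factor x(\<sigma> i)
  adds a box to row \<open>i\<close>, and only \<open>i = 0\<close> survives, so coefficients
  \<open>c\<close> matter only through \<open>c 0\<close>. Taking all coefficients 1 computes the
  surviving term \<open>Z 0\<close> (Pieri's rule for one box), and D - 1 is the top staircase
  entry.\<close>

lemma alternant_staircase_times:
  assumes "0 < D"
  shows "(\<Sum>\<sigma> | \<sigma> permutes {0..<D}. of_int (sign \<sigma>) * (\<Prod>i\<in>{0..<D}. x (\<sigma> i) ^ (D - 1 - i)) *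
            (\<Sum>i\<in>{0..<D}. real (D - 1 - i) * x (\<sigma> i)))
     = (real D - 1) * (\<Sum>i\<in>{0..<D}. x i) * alternant D x (\<lambda>i. D - 1 - i)"
proof -
  define Z where "Z = (\<lambda>i. alternant D x (\<lambda>j. D - 1 - j + (if j = i then 1 else 0)))"
  have Z: "Z i = (\<Sum>\<sigma> | \<sigma> permutes {0..<D}. of_int (sign \<sigma>) * (\<Prod>j\<in>{0..<D}. x (\<sigma> j) ^ (D - 1 - j)) * x (\<sigma> i))"
    if "i < D" for i
  proof -
    have "(\<Prod>j\<in>{0..<D}. x (\<sigma> j) ^ (D - 1 - j + (if j = i then 1 else 0))) =
      (\<Prod>j\<in>{0..<D}. x (\<sigma> j) ^ (D - 1 - j)) * x (\<sigma> i)" for \<sigma>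
    proof -
      have "(\<Prod>j\<in>{0..<D}. x (\<sigma> j) ^ (D - 1 - j + (if j = i then 1 else 0))) =
        (\<Prod>j\<in>{0..<D}. x (\<sigma> j) ^ (D - 1 - j)) * (\<Prod>j\<in>{0..<D}. if j = i then x (\<sigma> j) else 1)"
        unfolding prod.distrib[symmetric] power_add by (rule prod.cong) auto
      also have "(\<Prod>j\<in>{0..<D}. if j = i then x (\<sigma> j) else 1) = x (\<sigma> i)" using that by simp
      finally show ?thesis .
    qed
    then show ?thesis by (simp add: Z_def alternant_def mult.assoc)
  qed
  \<comment> \<open>Adding a box to a row below the first repeats an exponent.\<close>
  have Z0: "Z (Suc i) = 0" if "Suc i < D" for i
  proof -
    let ?v = "\<lambda>j. D - 1 - j + (if j = Suc i then 1 else 0)"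
    have "?v (Transposition.transpose i (Suc i) j) = ?v j" for j
      using that by (auto simp: Transposition.transpose_def)
    then have "alternant D x ?v = - alternant D x ?v"
      using alternant_transpose[of i D "Suc i" x ?v] that by simp
    then show ?thesis by (simp add: Z_def)
  qed
  have "(\<Sum>i\<in>{0..<D}. c i * Z i) = c 0 * Z 0" for c :: "nat \<Rightarrow> real"
  proof -
    have "(\<Sum>i\<in>{0..<D}. c i * Z i) = (\<Sum>i\<in>{0..<D}. if i = 0 then c i * Z i else 0)"
    proof (rule sum.cong)
      fix i assume "i \<in> {0..<D}"
      then show "c i * Z i = (if i = 0 then c i * Z i else 0)" using Z0[of "i - 1"] by (cases i) auto
    qed simp
    then show ?thesis using assms by simp
  qed
  note only0 = this
  have swap: "(\<Sum>i\<in>{0..<D}. c i * Z i) =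
    (\<Sum>\<sigma> | \<sigma> permutes {0..<D}. of_int (sign \<sigma>) * (\<Prod>j\<in>{0..<D}. x (\<sigma> j) ^ (D - 1 - j)) * (\<Sum>i\<in>{0..<D}. c i * x (\<sigma> i)))"
    for c :: "nat \<Rightarrow> real"
  proof -
    have "(\<Sum>i\<in>{0..<D}. c i * Z i) = (\<Sum>i\<in>{0..<D}. \<Sum>\<sigma> | \<sigma> permutes {0..<D}.
        of_int (sign \<sigma>) * (\<Prod>j\<in>{0..<D}. x (\<sigma> j) ^ (D - 1 - j)) * (c i * x (\<sigma> i)))"
      by (rule sum.cong) (auto simp: Z sum_distrib_left mult_ac)
    then show ?thesis by (subst (asm) sum.swap) (simp add: sum_distrib_left)
  qed
  have "Z 0 = (\<Sum>\<sigma> | \<sigma> permutes {0..<D}. of_int (sign \<sigma>) * (\<Prod>j\<in>{0..<D}. x (\<sigma> j) ^ (D - 1 - j)) * (\<Sum>i\<in>{0..<D}. 1 * x (\<sigma> i)))"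
    using swap[of "\<lambda>_. 1"] only0[of "\<lambda>_. 1"] by simp
  also have "\<dots> = (\<Sum>\<sigma> | \<sigma> permutes {0..<D}. of_int (sign \<sigma>) * (\<Prod>j\<in>{0..<D}. x (\<sigma> j) ^ (D - 1 - j)) * (\<Sum>i\<in>{0..<D}. x i))"
  proof (rule sum.cong)
    fix \<sigma> assume "\<sigma> \<in> {\<sigma>. \<sigma> permutes {0..<D}}"
    then have "(\<Sum>i\<in>{0..<D}. 1 * x (\<sigma> i)) = (\<Sum>i\<in>{0..<D}. x i)"
      using sum.permute[of \<sigma> "{0..<D}" x] by (simp add: o_def)
    then show "of_int (sign \<sigma>) * (\<Prod>j\<in>{0..<D}. x (\<sigma> j) ^ (D - 1 - j)) * (\<Sum>i\<in>{0..<D}. 1 * x (\<sigma> i)) =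
       of_int (sign \<sigma>) * (\<Prod>j\<in>{0..<D}. x (\<sigma> j) ^ (D - 1 - j)) * (\<Sum>i\<in>{0..<D}. x i)" by simp
  qed simp
  also have "\<dots> = (\<Sum>i\<in>{0..<D}. x i) * alternant D x (\<lambda>i. D - 1 - i)"
    unfolding alternant_def sum_distrib_right[symmetric] by (rule mult.commute)
  finally have "Z 0 = (\<Sum>i\<in>{0..<D}. x i) * alternant D x (\<lambda>i. D - 1 - i)" .
  moreover have "(\<Sum>i\<in>{0..<D}. real (D - 1 - i) * Z i) = (real D - 1) * Z 0"
    using only0[of "\<lambda>i. real (D - 1 - i)"] assms by (simp add: of_nat_diff)
  ultimately show ?thesis using swap[of "\<lambda>i. real (D - 1 - i)"] by simp
qed

text \<open>Reflecting the whole word exchanges the multiplicities of \<open>a\<close> and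
  \<open>Suc a\<close>. With \<open>m = n\<close> no walk remains after the prefix, so the premise
  of \<open>stable\<close> is automatic and the shape is kept.\<close>

lemma sum_words_swap_adjacent:
  fixes Q :: "nat list \<Rightarrow> real"
  assumes Q: "\<And>w w'. (\<And>k. greene_on w' {0..<D} k = greene_on w {0..<D} k) \<Longrightarrow> Q w' = Q w"
    and a: "Suc a < D"
  shows "(\<Sum>w\<in>words D n. word_weight (x \<circ> Transposition.transpose a (Suc a)) w * Q w) = (\<Sum>w\<in>words D n. word_weight x w * Q w)"
proof (rule sum.reindex_bij_witness[of _ "reflect a n" "reflect a n"])
  let ?t = "Transposition.transpose a (Suc a)"
  fix w assume w: "w \<in> words D n"
  let ?v = "reflect a n w"
  have n: "n \<le> length w" "length w = n" using w by (auto simp: words_def)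
  note R = reflect_props[OF n(1), of a]
  have dw: "differ_within a n w ?v" using R(2) by (simp add: stable_def)
  have "set ?v \<subseteq> {..D}"
    by (rule differ_within_counts(3)[OF dw n(1)]) (use w a in \<open>auto simp: words_def\<close>)
  then show v: "?v \<in> words D n" using dw n by (simp add: words_def differ_within_def)
  show "reflect a n ?v = w" by (rule R(3))
  show "?v \<in> words D n" "reflect a n ?v = w" using v R(3) by auto
  have "greene_on ?v {0..<D} k = greene_on w {0..<D} k" for k
    using R(2) a n unfolding stable_def by simp
  then have Qv: "Q ?v = Q w" by (rule Q)
  have len: "length ?v = n" using v by (simp add: words_def)
  have "int (count_list ?v a) - int (count_list ?v (Suc a)) = - (int (count_list w a) - int (count_list w (Suc a)))"
    using R(1) walk_height_length[of a ?v] walk_height_length[of a w] len n by simp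
  moreover have "count_list ?v a + count_list ?v (Suc a) = count_list w a + count_list w (Suc a)"
    by (rule differ_within_counts(2)[OF dw n(1)])
  ultimately have "count_list ?v a = count_list w (Suc a)" "count_list ?v (Suc a) = count_list w a" by linarith+
  then have c: "count_list ?v (?t i) = count_list w i" for i
    using differ_within_counts(1)[OF dw n(1), of i] by (auto simp: Transposition.transpose_def)
  have t: "?t permutes {..D}" by (rule permutes_swap_id) (use a in auto)
  have "word_weight x ?v = (\<Prod>l\<le>D. x (?t l) ^ count_list ?v (?t l))"
    unfolding word_weight_counts[OF v] using prod.permute[OF t, of "\<lambda>l. x l ^ count_list ?v l"] by (simp add: o_def)
  then have "word_weight x ?v = word_weight (x \<circ> ?t) w"
    unfolding word_weight_counts[OF w] c by simp
  then show "word_weight x ?v * Q ?v = word_weight (x \<circ> ?t) w * Q w" using Qv by simp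
qed

text \<open>The analogue of the symmetry of Schur polynomials: adjacent transpositions generate all
  permutations of the active letters.\<close>

lemma sum_words_permute:
  fixes Q :: "nat list \<Rightarrow> real"
  assumes Q: "\<And>w w'. (\<And>k. greene_on w' {0..<D} k = greene_on w {0..<D} k) \<Longrightarrow> Q w' = Q w"
    and \<sigma>: "\<sigma> permutes {0..<D}"
  shows "(\<Sum>w\<in>words D n. word_weight (x \<circ> \<sigma>) w * Q w) = (\<Sum>w\<in>words D n. word_weight x w * Q w)"
proof -
  define invariant where "invariant = (\<lambda>\<sigma>. \<forall>x. (\<Sum>w\<in>words D n. word_weight (x \<circ> \<sigma>) w * Q w) = (\<Sum>w\<in>words D n. word_weight x w * Q w))"
  have comp: "invariant (\<sigma> \<circ> \<tau>)" if "invariant \<sigma>" "invariant \<tau>" for \<sigma> \<tau>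
    using that unfolding invariant_def by (simp add: o_assoc)
  have adj: "invariant (Transposition.transpose a (Suc a))" if "Suc a < D" for a
    unfolding invariant_def
  proof (rule allI)
    fix x
    show "(\<Sum>w\<in>words D n. word_weight (x \<circ> Transposition.transpose a (Suc a)) w * Q w) = (\<Sum>w\<in>words D n. word_weight x w * Q w)"
      by (rule sum_words_swap_adjacent[OF _ that]) (fact Q)
  qed
  have less: "invariant (Transposition.transpose a b)" if "a < b" "b < D" for a b
    using that
  proof (induction b)
    case (Suc b)
    show ?case
    proof (cases "a = b")
      case False
      then have "invariant (Transposition.transpose b (Suc b) \<circ> (Transposition.transpose a b \<circ> Transposition.transpose b (Suc b)))"
        using Suc adj[of b] by (intro comp) auto
      moreover have "Transposition.transpose b (Suc b) \<circ> (Transposition.transpose a b \<circ> Transposition.transpose b (Suc b)) = Transposition.transpose a (Suc b)"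
        using False Suc.prems by (auto simp: fun_eq_iff Transposition.transpose_def)
      ultimately show ?thesis by simp
    qed (use adj Suc in simp)
  qed simp
  have "invariant \<sigma>"
    using \<sigma> finite_atLeastLessThan
  proof (induction rule: permutes_induct)
    case id
    then show ?case by (simp add: invariant_def comp_def)
  next
    case (swap a b p)
    then have "invariant (Transposition.transpose a b)"
      using less[of a b] less[of b a] by (cases a b rule: linorder_cases) (auto simp: transpose_commute)
    then show ?case using comp swap by blast
  qed
  then show ?thesis by (simp add: invariant_def)
qed

text \<open>On Yamanouchi words this is the sum of the squared \<open>shifted_weight\<close>s, which
  the involution merely permutes; the unshifted sum of squared multiplicities would not be
  invariant.\<close>

definition staircase_energy :: "nat \<Rightarrow> nat list \<Rightarrow> real" where
  "staircase_energy D w = (\<Sum>i<D. (row_length w {0..<D} i + real (D - 1 - i))\<^sup>2)"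

lemma alternant_word_expand:
  assumes w: "w \<in> words D n"
  shows "x D ^ count_list w D * alternant D x (shifted_weight D w) =
    (\<Sum>\<sigma> | \<sigma> permutes {0..<D}. of_int (sign \<sigma>) * (\<Prod>i\<in>{0..<D}. x (\<sigma> i) ^ (D - 1 - i)) * word_weight (x \<circ> \<sigma>) w)"
  unfolding alternant_def sum_distrib_left
proof (rule sum.cong)
  fix \<sigma> assume "\<sigma> \<in> {\<sigma>. \<sigma> permutes {0..<D}}"
  \<comment> \<open>Permutations of the active letters fix the blank, so its power factors out of
    the antisymmetrisation.\<close>
  then have "\<sigma> D = D" by (simp add: permutes_def)
  have "{..D} = insert D {0..<D}" by auto
  then have "word_weight (x \<circ> \<sigma>) w = x D ^ count_list w D * (\<Prod>i\<in>{0..<D}. x (\<sigma> i) ^ count_list w i)"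
    unfolding word_weight_counts[OF w] using \<open>\<sigma> D = D\<close> by simp
  then show "x D ^ count_list w D * (of_int (sign \<sigma>) * (\<Prod>i\<in>{0..<D}. x (\<sigma> i) ^ shifted_weight D w i)) =
      of_int (sign \<sigma>) * (\<Prod>i\<in>{0..<D}. x (\<sigma> i) ^ (D - 1 - i)) * word_weight (x \<circ> \<sigma>) w"
    unfolding shifted_weight_def power_add prod.distrib by (simp add: mult_ac)
qed simp

text \<open>\<open>T\<close> changes sign under the involution, while the energy and its content
  version \<open>N\<close> do not. Their difference vanishes on Yamanouchi words, so both have the
  same sum against \<open>T\<close>. Expanding \<open>T\<close> over permutations, symmetry pulls
  the energy sum out as one factor, and \<open>N\<close> leaves only moments of letter
  counts.\<close>

lemma energy_times_alternant:
  assumes x: "(\<Sum>l\<le>D. x l) = 1" and D: "0 < D"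
  shows "(\<Sum>w\<in>words D n. word_weight x w * staircase_energy D w) * alternant D x (\<lambda>i. D - 1 - i) =
    (real n * (real n - 1) * (\<Sum>i<D. (x i)\<^sup>2) + real n * (\<Sum>i<D. x i) + (\<Sum>i<D. (real (D - 1 - i))\<^sup>2)
      + 2 * real n * (real D - 1) * (\<Sum>i<D. x i)) * alternant D x (\<lambda>i. D - 1 - i)"
proof -
  let ?P = "{\<sigma>. \<sigma> permutes {0..<D}}"
  define \<delta> where "\<delta> = (\<lambda>\<sigma>. of_int (sign \<sigma>) * (\<Prod>i\<in>{0..<D}. x (\<sigma> i) ^ (D - 1 - i)))"
  have ad: "alternant D x (\<lambda>i. D - 1 - i) = (\<Sum>\<sigma>\<in>?P. \<delta> \<sigma>)" by (simp add: alternant_def \<delta>_def)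
  define T where "T = (\<lambda>w. x D ^ count_list w D * alternant D x (shifted_weight D w))"
  define N where "N = (\<lambda>w. \<Sum>i<D. (real (shifted_weight D w i))\<^sup>2)"
  have sub: "(\<Sum>w\<in>words D n. (staircase_energy D w - N w) * T w) = 0"
  proof -
    have "(\<Sum>w\<in>words D n. (staircase_energy D w - N w) * T w) =
        (\<Sum>w\<in>{w\<in>words D n. yamanouchi {0..<D} w}. (staircase_energy D w - N w) * T w)"
    proof (rule sum_words_yamanouchi)
      fix w w' a
      assume w: "w \<in> words D n" "w' \<in> words D n" and a: "Suc a < D"
        and g: "\<And>k. greene_on w' {0..<D} k = greene_on w {0..<D} k"
        and s: "\<And>i. shifted_weight D w' i = shifted_weight D w (Transposition.transpose a (Suc a) i)"
      have "staircase_energy D w' = staircase_energy D w" by (simp add: staircase_energy_def row_length_def g)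
      moreover have "N w' = N w"
      proof -
        have "Transposition.transpose a (Suc a) permutes {..<D}" by (rule permutes_swap_id) (use a in auto)
        from sum.permute[OF this, of "\<lambda>i. (real (shifted_weight D w i))\<^sup>2"]
        show ?thesis by (simp add: N_def s o_def)
      qed
      moreover have "T w' = - T w"
      proof -
        have "count_list w' D = count_list w D" using s[of D] a by (simp add: shifted_weight_def Transposition.transpose_def)
        moreover have "shifted_weight D w' = (\<lambda>i. shifted_weight D w (Transposition.transpose a (Suc a) i))" using s by blast
        ultimately show ?thesis using alternant_transpose[of a D "Suc a" x "shifted_weight D w"] a by (simp add: T_def)
      qed
      ultimately show "(staircase_energy D w' - N w') * T w' = - ((staircase_energy D w - N w) * T w)" by simp
    qed
    also have "\<dots> = 0"
    proof (rule sum.neutral, rule ballI)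
      fix w assume "w \<in> {w\<in>words D n. yamanouchi {0..<D} w}"
      then have "row_length w {0..<D} i = real (count_list w i)" if "i < D" for i
        using row_length_yamanouchi[of 0 D w i] that by simp
      then have "staircase_energy D w = N w"
        unfolding staircase_energy_def N_def shifted_weight_def
        by (intro sum.cong refl) (simp only: lessThan_iff of_nat_add)
      then show "(staircase_energy D w - N w) * T w = 0" by simp
    qed
    finally show ?thesis .
  qed
  have exch: "(\<Sum>w\<in>words D n. H w * T w) = (\<Sum>\<sigma>\<in>?P. \<delta> \<sigma> * (\<Sum>w\<in>words D n. word_weight (x \<circ> \<sigma>) w * H w))" for H
  proof -
    have "(\<Sum>w\<in>words D n. H w * T w) = (\<Sum>w\<in>words D n. \<Sum>\<sigma>\<in>?P. \<delta> \<sigma> * (word_weight (x \<circ> \<sigma>) w * H w))"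
    proof (rule sum.cong)
      fix w assume "w \<in> words D n"
      then have "T w = (\<Sum>\<sigma>\<in>?P. \<delta> \<sigma> * word_weight (x \<circ> \<sigma>) w)"
        unfolding T_def \<delta>_def by (rule alternant_word_expand)
      then show "H w * T w = (\<Sum>\<sigma>\<in>?P. \<delta> \<sigma> * (word_weight (x \<circ> \<sigma>) w * H w))"
        by (simp add: sum_distrib_left mult_ac)
    qed simp
    also have "\<dots> = (\<Sum>\<sigma>\<in>?P. \<Sum>w\<in>words D n. \<delta> \<sigma> * (word_weight (x \<circ> \<sigma>) w * H w))" by (rule sum.swap)
    finally show ?thesis by (simp add: sum_distrib_left)
  qed
  have "(\<Sum>w\<in>words D n. staircase_energy D w * T w) = (\<Sum>\<sigma>\<in>?P. \<delta> \<sigma> * (\<Sum>w\<in>words D n. word_weight x w * staircase_energy D w))"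
    unfolding exch
  proof (rule sum.cong)
    fix \<sigma> assume "\<sigma> \<in> ?P"
    then have "\<sigma> permutes {0..<D}" by simp
    then have "(\<Sum>w\<in>words D n. word_weight (x \<circ> \<sigma>) w * staircase_energy D w) = (\<Sum>w\<in>words D n. word_weight x w * staircase_energy D w)"
      by (rule sum_words_permute[rotated]) (simp add: staircase_energy_def row_length_def)
    then show "\<delta> \<sigma> * (\<Sum>w\<in>words D n. word_weight (x \<circ> \<sigma>) w * staircase_energy D w) =
        \<delta> \<sigma> * (\<Sum>w\<in>words D n. word_weight x w * staircase_energy D w)" by simp
  qed simp
  then have lhs: "(\<Sum>w\<in>words D n. staircase_energy D w * T w) = (\<Sum>w\<in>words D n. word_weight x w * staircase_energy D w) * alternant D x (\<lambda>i. D - 1 - i)"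
    unfolding ad by (simp add: sum_distrib_right mult.commute)
  have N_exp: "N w = (\<Sum>i<D. (real (count_list w i))\<^sup>2 + 2 * real (D - 1 - i) * real (count_list w i) + (real (D - 1 - i))\<^sup>2)" for w
    unfolding N_def by (rule sum.cong) (auto simp: shifted_weight_def power2_eq_square algebra_simps)
  \<comment> \<open>\<open>C\<close> collects what does not depend on the permutation; only the
    cross term with the staircase does.\<close>
  define C where "C = real n * (real n - 1) * (\<Sum>i<D. (x i)\<^sup>2) + real n * (\<Sum>i<D. x i) + (\<Sum>i<D. (real (D - 1 - i))\<^sup>2)"
  have "(\<Sum>w\<in>words D n. N w * T w) = (\<Sum>\<sigma>\<in>?P. \<delta> \<sigma> * (C + 2 * real n * (\<Sum>i\<in>{0..<D}. real (D - 1 - i) * x (\<sigma> i))))"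
    unfolding exch
  proof (rule sum.cong)
    fix \<sigma> assume "\<sigma> \<in> ?P"
    then have \<sigma>: "\<sigma> permutes {..<D}" "\<sigma> permutes {..D}"
      by (auto simp: lessThan_atLeast0 intro: permutes_subset)
    have y: "(\<Sum>l\<le>D. (x \<circ> \<sigma>) l) = 1" using sum.permute[OF \<sigma>(2), of x] x by simp
    have "(\<Sum>w\<in>words D n. word_weight (x \<circ> \<sigma>) w * N w) =
       (\<Sum>i<D. \<Sum>w\<in>words D n. word_weight (x \<circ> \<sigma>) w * (real (count_list w i))\<^sup>2 +
          2 * real (D - 1 - i) * (word_weight (x \<circ> \<sigma>) w * real (count_list w i)) + (real (D - 1 - i))\<^sup>2 * word_weight (x \<circ> \<sigma>) w)"
      unfolding N_exp sum_distrib_left by (subst sum.swap) (intro sum.cong refl, simp add: algebra_simps)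
    also have "\<dots> = (\<Sum>i<D. real n * (real n - 1) * (x (\<sigma> i))\<^sup>2 + real n * x (\<sigma> i) +
          2 * real (D - 1 - i) * (real n * x (\<sigma> i)) + (real (D - 1 - i))\<^sup>2)"
      by (intro sum.cong refl)
         (simp add: sum.distrib sum_distrib_left[symmetric] sum_word_weight[OF y] sum_word_weight_count[OF y] sum_word_weight_count_sq[OF y])
    also have "\<dots> = real n * (real n - 1) * (\<Sum>i<D. (x (\<sigma> i))\<^sup>2) + real n * (\<Sum>i<D. x (\<sigma> i)) + (\<Sum>i<D. (real (D - 1 - i))\<^sup>2)
       + 2 * real n * (\<Sum>i\<in>{0..<D}. real (D - 1 - i) * x (\<sigma> i))"
      by (simp add: sum.distrib sum_distrib_left lessThan_atLeast0 mult_ac)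
    also have "(\<Sum>i<D. (x (\<sigma> i))\<^sup>2) = (\<Sum>i<D. (x i)\<^sup>2)" using sum.permute[OF \<sigma>(1), of "\<lambda>i. (x i)\<^sup>2"] by (simp add: o_def)
    also have "(\<Sum>i<D. x (\<sigma> i)) = (\<Sum>i<D. x i)" using sum.permute[OF \<sigma>(1), of x] by (simp add: o_def)
    finally show "\<delta> \<sigma> * (\<Sum>w\<in>words D n. word_weight (x \<circ> \<sigma>) w * N w) =
        \<delta> \<sigma> * (C + 2 * real n * (\<Sum>i\<in>{0..<D}. real (D - 1 - i) * x (\<sigma> i)))" by (simp only: C_def)
  qed simp
  also have "\<dots> = C * (\<Sum>\<sigma>\<in>?P. \<delta> \<sigma>) + 2 * real n * (\<Sum>\<sigma>\<in>?P. \<delta> \<sigma> * (\<Sum>i\<in>{0..<D}. real (D - 1 - i) * x (\<sigma> i)))"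
    by (simp add: distrib_left sum.distrib sum_distrib_left mult_ac)
  also have "(\<Sum>\<sigma>\<in>?P. \<delta> \<sigma> * (\<Sum>i\<in>{0..<D}. real (D - 1 - i) * x (\<sigma> i))) =
      (real D - 1) * (\<Sum>i\<in>{0..<D}. x i) * alternant D x (\<lambda>i. D - 1 - i)"
    unfolding \<delta>_def by (rule alternant_staircase_times[OF D])
  finally have "(\<Sum>w\<in>words D n. N w * T w) = (C + 2 * real n * (real D - 1) * (\<Sum>i<D. x i)) * alternant D x (\<lambda>i. D - 1 - i)"
    unfolding ad[symmetric] by (simp only: distrib_right mult.assoc lessThan_atLeast0)
  moreover have "(\<Sum>w\<in>words D n. staircase_energy D w * T w) = (\<Sum>w\<in>words D n. N w * T w)"
    using sub by (simp add: left_diff_distrib sum_subtractf)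
  ultimately show ?thesis using lhs by (simp add: C_def)
qed

section \<open>The expected energy\<close>

text \<open>The alternant can be cancelled where the active weights are distinct; both sides are
  continuous in the weights, which gives the remaining case.\<close>

lemma sum_staircase_energy:
  assumes x: "(\<Sum>l\<le>D. x l) = 1" and D: "0 < D"
  shows "(\<Sum>w\<in>words D n. word_weight x w * staircase_energy D w) =
    real n * (real n - 1) * (\<Sum>i<D. (x i)\<^sup>2) + real n * (\<Sum>i<D. x i) + (\<Sum>i<D. (real (D - 1 - i))\<^sup>2)
      + 2 * real n * (real D - 1) * (\<Sum>i<D. x i)"
proof -
  define L where "L = (\<lambda>y. \<Sum>w\<in>words D n. word_weight y w * staircase_energy D w)"
  define R where "R = (\<lambda>y. real n * (real n - 1) * (\<Sum>i<D. (y i)\<^sup>2) + real n * (\<Sum>i<D. y i) + (\<Sum>i<D. (real (D - 1 - i))\<^sup>2)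
      + 2 * real n * (real D - 1) * (\<Sum>i<D. y i))"
  \<comment> \<open>Perturb \<open>x\<close> to make the active coordinates distinct; the blank absorbs the change of mass.\<close>
  define y where "y = (\<lambda>t l. if l < D then x l + t * real l else 1 - (\<Sum>i<D. x i + t * real i))"
  have y0: "y 0 l = x l" if "l \<le> D" for l
  proof -
    have "{..D} = insert D {..<D}" by auto
    then have "x D = 1 - (\<Sum>i<D. x i)" using x by simp
    then show ?thesis using that by (cases "l = D") (auto simp: y_def)
  qed
  have ysum: "(\<Sum>l\<le>D. y t l) = 1" for t
  proof -
    have "{..D} = insert D {..<D}" by auto
    then show ?thesis by (simp add: y_def)
  qed
  have lim: "((\<lambda>t. y t l) \<longlongrightarrow> y 0 l) (at 0)" for l
    unfolding y_def by (cases "l < D") (auto intro!: tendsto_eq_intros)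
  have "\<forall>\<^sub>F t in at (0::real). \<forall>(i, j)\<in>{0..<D} \<times> {0..<D}. i \<noteq> j \<longrightarrow> y t i \<noteq> y t j"
  proof (rule eventually_ball_finite)
    show "\<forall>p\<in>{0..<D} \<times> {0..<D}. \<forall>\<^sub>F t in at (0::real). case p of (i, j) \<Rightarrow> i \<noteq> j \<longrightarrow> y t i \<noteq> y t j"
    proof (clarify)
      fix i j assume ij: "i \<in> {0..<D}" "j \<in> {0..<D}"
      \<comment> \<open>For \<open>i \<noteq> j\<close> the two perturbed weights agree only at this
        \<open>t\<close>; for \<open>i = j\<close> the quotient is 0 by convention and the claim is
        vacuous.\<close>
      have "\<forall>\<^sub>F t in at (0::real). t \<noteq> (x i - x j) / (real j - real i)"
        by (rule eventually_neq_at_within)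
      then show "\<forall>\<^sub>F t in at (0::real). i \<noteq> j \<longrightarrow> y t i \<noteq> y t j"
      proof eventually_elim
        case (elim t)
        show ?case
        proof
          assume "i \<noteq> j"
          then have "real j - real i \<noteq> 0" by simp
          with elim show "y t i \<noteq> y t j" using ij by (auto simp: y_def field_simps)
        qed
      qed
    qed
  qed simp
  then have ev: "\<forall>\<^sub>F t in at (0::real). L (y t) = R (y t)"
  proof eventually_elim
    case (elim t)
    then have "inj_on (y t) {0..<D}" by (force simp: inj_on_def)
    then have "alternant D (y t) (\<lambda>i. D - 1 - i) \<noteq> 0"
      unfolding alternant_def by (rule vandermonde_nonzero)
    then show ?case using energy_times_alternant[OF ysum D, of t n] by (simp add: L_def R_def)
  qed
  have "((\<lambda>t. word_weight (y t) w) \<longlongrightarrow> word_weight (y 0) w) (at 0)" if "w \<in> words D n" for w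
    unfolding word_weight_counts[OF that] by (intro tendsto_prod tendsto_power lim)
  then have "((\<lambda>t. L (y t)) \<longlongrightarrow> L (y 0)) (at 0)"
    unfolding L_def by (intro tendsto_sum tendsto_mult tendsto_const)
  moreover have "((\<lambda>t. R (y t)) \<longlongrightarrow> R (y 0)) (at 0)"
    unfolding R_def by (intro tendsto_add tendsto_mult tendsto_const tendsto_sum tendsto_power lim)
  ultimately have "L (y 0) = R (y 0)"
    using tendsto_cong[OF ev] tendsto_unique[OF at_neq_bot] by metis
  moreover have "L (y 0) = L x"
    unfolding L_def by (intro sum.cong refl) (simp add: word_weight_counts y0)
  moreover have "R (y 0) = R x" unfolding R_def by (simp add: y0)
  ultimately show ?thesis by (simp add: L_def R_def)
qed

lemma sum_squared_row_lengths_le: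
  assumes x: "(\<Sum>l\<le>D. x l) = 1" and D: "0 < D" and nonneg: "\<And>l. l \<le> D \<Longrightarrow> 0 \<le> x l"
  shows "(\<Sum>w\<in>words D n. word_weight x w * (\<Sum>i<D. (row_length w {0..<D} i)\<^sup>2)) \<le>
    real n * (real n - 1) * (\<Sum>i<D. (x i)\<^sup>2) + real D * real n * (\<Sum>i<D. x i)"
proof -
  let ?\<Delta> = "\<Sum>i<D. (real (D - 1 - i))\<^sup>2"
  \<comment> \<open>The cross term contributes 2(D - 1) times the number of active letters, and
    Chebyshev gives back at most D - 1 times that number. Letter counts replace row lengths in the
    linear term because their means are known.\<close>
  have "(\<Sum>i<D. (row_length w {0..<D} i)\<^sup>2) \<le> staircase_energy D w - (real D - 1) * (\<Sum>i<D. real (count_list w i)) - ?\<Delta>" for w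
  proof -
    have "(\<Sum>i<D. real (count_list w i)) = real (card (active w {0..<D}))"
    proof -
      have "active w {0..<D} = (\<Union>i<D. {p. p < length w \<and> w ! p = i})" by (auto simp: active_def)
      moreover have "card (\<Union>i<D. {p. p < length w \<and> w ! p = i}) = (\<Sum>i<D. card {p. p < length w \<and> w ! p = i})"
        by (rule card_UN_disjoint) auto
      ultimately show ?thesis by (simp add: count_list_card)
    qed
    also have "\<dots> = (\<Sum>i<D. row_length w {0..<D} i)" using sum_row_eq_card_active[of w 0 D] by simp
    finally have count: "(\<Sum>i<D. real (count_list w i)) = (\<Sum>i<D. row_length w {0..<D} i)" .
    \<comment> \<open>The indices increase while the rows decrease, so the index may be replaced by
      its mean (D - 1)/2.\<close>
    have "real D * (\<Sum>i=0..<D. real i * row_length w {0..<D} i) \<le> (\<Sum>i=0..<D. real i) * (\<Sum>i=0..<D. row_length w {0..<D} i)"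
      by (rule Chebyshev_sum_upper) (auto intro: row_length_nonneg_antimono)
    also have "(\<Sum>i=0..<D. real i) = real D * (real D - 1) / 2"
      by (induction D) (auto simp: field_simps)
    finally have "real D * (2 * (\<Sum>i<D. real i * row_length w {0..<D} i)) \<le> real D * ((real D - 1) * (\<Sum>i<D. row_length w {0..<D} i))"
      by (simp add: lessThan_atLeast0)
    then have cheb: "2 * (\<Sum>i<D. real i * row_length w {0..<D} i) \<le> (real D - 1) * (\<Sum>i<D. row_length w {0..<D} i)"
      using D by simp
    have "staircase_energy D w = (\<Sum>i<D. (row_length w {0..<D} i)\<^sup>2 + (real (D - 1 - i))\<^sup>2 +
       (2 * (real D - 1) * row_length w {0..<D} i - 2 * (real i * row_length w {0..<D} i)))"
      unfolding staircase_energy_def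
      by (intro sum.cong refl) (simp add: of_nat_diff power2_eq_square algebra_simps)
    also have "\<dots> = (\<Sum>i<D. (row_length w {0..<D} i)\<^sup>2) + ?\<Delta> +
       (2 * (real D - 1) * (\<Sum>i<D. row_length w {0..<D} i) - 2 * (\<Sum>i<D. real i * row_length w {0..<D} i))"
      by (simp only: sum.distrib sum_subtractf sum_distrib_left)
    finally show ?thesis using cheb unfolding count by linarith
  qed
  then have "(\<Sum>w\<in>words D n. word_weight x w * (\<Sum>i<D. (row_length w {0..<D} i)\<^sup>2)) \<le>
     (\<Sum>w\<in>words D n. word_weight x w * (staircase_energy D w - (real D - 1) * (\<Sum>i<D. real (count_list w i)) - ?\<Delta>))"
    by (intro sum_mono mult_left_mono)
       (auto simp: word_weight_counts intro!: prod_nonneg zero_le_power nonneg)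
  also have "\<dots> = (\<Sum>w\<in>words D n. word_weight x w * staircase_energy D w)
      - (real D - 1) * (\<Sum>i<D. \<Sum>w\<in>words D n. word_weight x w * real (count_list w i)) - ?\<Delta> * (\<Sum>w\<in>words D n. word_weight x w)"
  proof -
    have "(\<Sum>w\<in>words D n. word_weight x w * (staircase_energy D w - (real D - 1) * (\<Sum>i<D. real (count_list w i)) - ?\<Delta>)) =
      (\<Sum>w\<in>words D n. word_weight x w * staircase_energy D w - (real D - 1) * (\<Sum>i<D. word_weight x w * real (count_list w i)) - ?\<Delta> * word_weight x w)"
      by (intro sum.cong refl) (simp add: right_diff_distrib sum_distrib_left mult_ac)
    then show ?thesis
      by (subst sum.swap) (simp only: sum_subtractf sum_distrib_left[symmetric])
  qed
  also have "\<dots> = real n * (real n - 1) * (\<Sum>i<D. (x i)\<^sup>2) + real D * real n * (\<Sum>i<D. x i)"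
    unfolding sum_staircase_energy[OF x D] sum_word_weight[OF x]
    by (simp add: sum_word_weight_count[OF x] sum_distrib_left[symmetric] algebra_simps)
  finally show ?thesis .
qed

section \<open>From weighted sums over words to expectations\<close>

lemma pmf_replicate_pmf:
  "length w = n \<Longrightarrow> pmf (replicate_pmf n p) w = word_weight (pmf p) w"
proof (induction n arbitrary: w)
  case 0
  then show ?case by (simp add: word_weight_def)
next
  case (Suc n)
  then obtain l v where w: "w = l # v" "length v = n" by (auto simp: length_Suc_conv)
  have "replicate_pmf (Suc n) p = map_pmf (\<lambda>(x, xs). x # xs) (pair_pmf p (replicate_pmf n p))"
    by (simp add: pair_pmf_def map_bind_pmf)
  moreover have "pmf (map_pmf (\<lambda>(x, xs). x # xs) (pair_pmf p (replicate_pmf n p))) ((\<lambda>(x, xs). x # xs) (l, v)) = pmf (pair_pmf p (replicate_pmf n p)) (l, v)"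
    by (rule pmf_map_inj') (auto simp: inj_on_def)
  ultimately show ?case using Suc.IH[OF w(2)] w by (simp add: pmf_pair word_weight_def)
qed

lemma expectation_replicate_pmf:
  assumes "set_pmf p \<subseteq> {..D}"
  shows "measure_pmf.expectation (replicate_pmf n p) f = (\<Sum>w\<in>words D n. word_weight (pmf p) w * (f w :: real))"
proof -
  have "set_pmf (replicate_pmf n p) \<subseteq> words D n"
    using assms by (auto simp: set_replicate_pmf words_def)
  then have "measure_pmf.expectation (replicate_pmf n p) f = (\<Sum>w\<in>words D n. pmf (replicate_pmf n p) w *\<^sub>R f w)"
    by (intro integral_measure_pmf) auto
  also have "\<dots> = (\<Sum>w\<in>words D n. word_weight (pmf p) w * f w)"
    by (rule sum.cong) (auto simp: words_def pmf_replicate_pmf)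
  finally show ?thesis .
qed

lemma map_replicate_pmf: "map_pmf (map f) (replicate_pmf n p) = replicate_pmf n (map_pmf f p)"
proof (induction n)
  case (Suc n)
  have "map_pmf (map f) (replicate_pmf (Suc n) p) =
      bind_pmf p (\<lambda>x. bind_pmf (map_pmf (map f) (replicate_pmf n p)) (\<lambda>xs. return_pmf (f x # xs)))"
    by (simp add: map_bind_pmf bind_map_pmf)
  then show ?case unfolding Suc by (simp add: bind_map_pmf)
qed simp

text \<open>Relabelling keeps every position: letters from \<open>k\<close> on become 0, ..., d - k
  in the same order, and all smaller ones become the blank, which lies outside the active
  alphabet.\<close>

lemma row_length_shift:
  assumes "set w \<subseteq> {1..d}"
  shows "row_length (map (\<lambda>l. if k \<le> l then l - k else Suc d - k) w) {0..<Suc d - k} j = row_length w {k..<Suc d} j"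
proof -
  let ?v = "map (\<lambda>l. if k \<le> l then l - k else Suc d - k) w"
  have act: "active ?v {0..<Suc d - k} = active w {k..<Suc d}"
  proof -
    have "w ! p \<le> d" if "p < length w" for p using assms nth_mem[OF that] by auto
    then show ?thesis by (auto simp: active_def split: if_splits)
  qed
  have "greene_on ?v {0..<Suc d - k} m = greene_on w {k..<Suc d} m" for m
  proof (rule antisym)
    show "greene_on ?v {0..<Suc d - k} m \<le> greene_on w {k..<Suc d} m"
      by (rule greene_on_mono_positions, unfold act) (auto simp: active_def)
    show "greene_on w {k..<Suc d} m \<le> greene_on ?v {0..<Suc d - k} m"
      by (rule greene_on_mono_positions, unfold act) (auto simp: active_def)
  qed
  then show ?thesis by (simp add: row_length_def)
qed

theorem mainTheorem9:
  fixes \<alpha> :: "nat pmf" and d n k :: nat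
  assumes "set_pmf \<alpha> \<subseteq> {1..d}"
    and "\<And>i. 1 \<le> i \<Longrightarrow> i < d \<Longrightarrow> pmf \<alpha> i \<ge> pmf \<alpha> (Suc i)"
    and "k \<in> {1..d}"
  shows "measure_pmf.expectation (SW n \<alpha>) (\<lambda>sh. \<Sum>i=k..d. real (sh i) ^ 2)
     \<le> (\<Sum>i=k..d. (pmf \<alpha> i * real n) ^ 2) + real d * (\<Sum>i=k..d. pmf \<alpha> i) * real n"
proof -
  define D where "D = Suc d - k"
  \<comment> \<open>Letters below \<open>k\<close> merge into the blank \<open>D\<close>, which
    carries their total mass.\<close>
  define \<tau> where "\<tau> = (\<lambda>l. if k \<le> l then l - k else D)"
  define \<beta> where "\<beta> = map_pmf \<tau> \<alpha>"
  have k: "1 \<le> k" "k \<le> d" using assms(3) by auto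
  have D: "0 < D" "D \<le> d" using k by (auto simp: D_def)
  have set\<beta>: "set_pmf \<beta> \<subseteq> {..D}" 
  proof -
    have "\<tau> l \<le> D" if "l \<in> set_pmf \<alpha>" for l
      using subsetD[OF assms(1) that] by (auto simp: \<tau>_def D_def)
    then show ?thesis by (auto simp: \<beta>_def)
  qed
  have pmf\<beta>: "pmf \<beta> i = pmf \<alpha> (k + i)" if "i < D" for i
  proof -
    have "\<tau> -` {i} = {k + i}" using that by (auto simp: \<tau>_def split: if_splits)
    then show ?thesis by (simp add: \<beta>_def pmf_map measure_pmf_single)
  qed
  have shift: "(\<Sum>i=k..d. g i) = (\<Sum>i<D. g (k + i))" for g :: "nat \<Rightarrow> real"
    by (rule sum.reindex_bij_witness[of _ "\<lambda>i. k + i" "\<lambda>i. i - k"]) (use k in \<open>auto simp: D_def\<close>)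
  have fin: "finite (set_pmf (replicate_pmf n \<alpha>))"
  proof (rule finite_subset)
    show "set_pmf (replicate_pmf n \<alpha>) \<subseteq> words d n"
      using assms(1) by (auto simp: set_replicate_pmf words_def)
  qed simp
  have "measure_pmf.expectation (SW n \<alpha>) (\<lambda>sh. \<Sum>i=k..d. real (sh i) ^ 2) =
      measure_pmf.expectation (replicate_pmf n \<alpha>) (\<lambda>w. \<Sum>i=k..d. (real (shRSK w i))\<^sup>2)"
    by (simp add: SW_def)
  also have "\<dots> \<le> measure_pmf.expectation (replicate_pmf n \<alpha>) (\<lambda>w. \<Sum>j<D. (row_length (map \<tau> w) {0..<D} j)\<^sup>2)"
  proof (rule integral_mono_AE)
    show "AE w in measure_pmf (replicate_pmf n \<alpha>). (\<Sum>i=k..d. (real (shRSK w i))\<^sup>2) \<le> (\<Sum>j<D. (row_length (map \<tau> w) {0..<D} j)\<^sup>2)"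
    proof (rule AE_pmfI)
      fix w assume "w \<in> set_pmf (replicate_pmf n \<alpha>)"
      then have w: "set w \<subseteq> {1..d}" using assms(1) by (auto simp: set_replicate_pmf)
      have "row_length (map \<tau> w) {0..<D} j = row_length w {k..<Suc d} j" for j
        unfolding \<tau>_def D_def by (rule row_length_shift[OF w])
      then show "(\<Sum>i=k..d. (real (shRSK w i))\<^sup>2) \<le> (\<Sum>j<D. (row_length (map \<tau> w) {0..<D} j)\<^sup>2)"
        using lower_rows_weakly_majorized[OF w assms(3)] by (simp add: D_def)
    qed
  qed (use fin in \<open>auto intro: integrable_measure_pmf_finite\<close>)
  also have "\<dots> = measure_pmf.expectation (replicate_pmf n \<beta>) (\<lambda>w. \<Sum>j<D. (row_length w {0..<D} j)\<^sup>2)"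
    by (simp add: \<beta>_def flip: map_replicate_pmf)
  also have "\<dots> = (\<Sum>w\<in>words D n. word_weight (pmf \<beta>) w * (\<Sum>j<D. (row_length w {0..<D} j)\<^sup>2))"
    by (rule expectation_replicate_pmf[OF set\<beta>])
  also have "\<dots> \<le> real n * (real n - 1) * (\<Sum>i<D. (pmf \<beta> i)\<^sup>2) + real D * real n * (\<Sum>i<D. pmf \<beta> i)"
    by (rule sum_squared_row_lengths_le) (use D set\<beta> in \<open>auto intro: sum_pmf_eq_1\<close>)
  \<comment> \<open>The slack is n(n - 1) \<le> n^2 in the quadratic term and D \<le> d in the
    linear one.\<close>
  also have "\<dots> \<le> (real n)\<^sup>2 * (\<Sum>i<D. (pmf \<beta> i)\<^sup>2) + real d * real n * (\<Sum>i<D. pmf \<beta> i)"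
    using D by (intro add_mono mult_right_mono sum_nonneg) (auto simp: power2_eq_square algebra_simps)
  also have "\<dots> = (\<Sum>i=k..d. (pmf \<alpha> i * real n) ^ 2) + real d * (\<Sum>i=k..d. pmf \<alpha> i) * real n"
    unfolding shift by (simp add: pmf\<beta> sum_distrib_left power_mult_distrib mult_ac)
  finally show ?thesis .
qed

end
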